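(* The edge-based districting problem $\theta_{B,I,O}$ (unit edge weights, balance constraints, integral allocations, given centers, compactness objective, no contiguity) can be solved in polynomial time.
   Context: Edge-based districting. An instance consists of an undirected graph $G=(V,E)$, a positive integer $p \le |E|$ (districts indexed $1,\dots,p$), positive edge weights $b_e$ ($e \in E$), real bounds $\Phi_l \le \bar b \le \Phi_u$ where $\bar b = \frac{1}{p}\sum_{e\in E} b_e$, and (when centers are not selected) given center nodes $c_1,\dots,c_p \in V$, not necessarily distinct. Let $d_{u,v}$ be the shortest-path distance in $G$ with edge lengths $b_e$, and define $d_{v,(j,k)} = \min(d_{v,j}, d_{v,k}) + \alpha\, b_{(j,k)}$ for a fixed $\alpha \in [0,1]$. Variables: $x_{i,e}$ ($i\in\{1,\dots,p\}$, $e\in E$) and $w_{iv}$ ($w_{iv}=1$ iff $v$ is the center of district $i$). Constraint groups: (S, always present) $\sum_{i=1}^p x_{i,e}=1$ for all $e$, $\sum_{v\in V} w_{iv}=1$ for all $i$, $x_{i,e}\ge 0$, $w_{iv}\in\{0,1\}$. (B) $\Phi_l \le \sum_{e\in E} b_e x_{i,e} \le \Phi_u$ for all $i$. (C) for all $D\subseteq E$ and all $i$: $\sum_{e\in \delta(D)} x_{i,e} + \sum_{e\in D}(1-x_{i,e}) + \sum_{v\in V_D} w_{iv}\ge 1$, where $V_D$ is the set of vertices incident to an edge of $D$ and $\delta(D)$ the set of edges of $E\setminus D$ with an endpoint in $V_D$. (I) $x_{i,e}\in\{0,1\}$; if absent, $x_{i,e}\in[0,1]$ is continuous. (N) the $w_{iv}$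 are decision variables; if absent, fixed by $w_{iv}=1$ iff $v=c_i$. (O) minimize $\sum_{v\in V}\sum_{i=1}^p\sum_{e\in E} w_{iv}\, d_{v,e}\, x_{i,e}$; if absent, the objective is $0$. (W) arbitrary positive weights $b_e$; if absent, $b_e=1$ for all $e$. For $X\subseteq\{B,C,I,N,O,W\}$, $\theta_X$ denotes the problem with group S and exactly the groups in $X$. Solving $\theta_X$ means outputting an optimal solution (if $O\in X$) or a feasible one (otherwise), or reporting infeasibility. *)

theory Defs
  imports Complex_Main "HOL-Library.Extended_Real" "HOL-Computational_Algebra.Polynomial"
begin

section \<open>Polynomial time\<close>

text \<open>
  The machine model is the WHILE language over binary trees (N. D. Jones, Computability and
  Complexity from a Programming Perspective, MIT Press 1997). Evaluating an expression costs, for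
  each of its subexpressions, one unit plus the size of its value. So every tree that is handled is
  paid for in full (no free sharing of subtrees), the time bounds the size of the output, and
  polynomial time agrees with polynomial time on Turing machines.
\<close>

datatype tree = Leaf | Node tree tree

fun left :: "tree \<Rightarrow> tree" where
  "left Leaf = Leaf"
| "left (Node l r) = l"

fun right :: "tree \<Rightarrow> tree" where
  "right Leaf = Leaf"
| "right (Node l r) = r"

datatype exp = Var nat | LeafE | NodeE exp exp | LeftE exp | RightE exp

datatype com = Assign nat exp | Seq com com | Cond exp com com | While exp com

type_synonym state = "nat \<Rightarrow> tree"

fun val :: "exp \<Rightarrow> state \<Rightarrow> tree" where
  "val (Var i) s = s i"
| "val LeafE s = Leaf"
| "val (NodeE a b) s = Node (val a s) (val b s)"
| "val (LeftE a) s = left (val a s)"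
| "val (RightE a) s = right (val a s)"

fun cost :: "exp \<Rightarrow> state \<Rightarrow> nat" where
  "cost (Var i) s = 1 + size (s i)"
| "cost LeafE s = 1"
| "cost (NodeE a b) s = 1 + size (val (NodeE a b) s) + cost a s + cost b s"
| "cost (LeftE a) s = 1 + size (val (LeftE a) s) + cost a s"
| "cost (RightE a) s = 1 + size (val (RightE a) s) + cost a s"

text \<open>\<open>exec c s n s'\<close>: started in state \<open>s\<close>, the command \<open>c\<close> halts in state \<open>s'\<close> after time \<open>n\<close>.
  A test succeeds iff the value is not \<^term>\<open>Leaf\<close>.\<close>

inductive exec :: "com \<Rightarrow> state \<Rightarrow> nat \<Rightarrow> state \<Rightarrow> bool" where
  Assign: "exec (Assign i a) s (1 + cost a s) (s(i := val a s))"
| Seq: "exec c s m s' \<Longrightarrow> exec d s' n s'' \<Longrightarrow> exec (Seq c d) s (1 + m + n) s''"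
| CondTrue: "val a s \<noteq> Leaf \<Longrightarrow> exec c s n s' \<Longrightarrow> exec (Cond a c d) s (1 + cost a s + n) s'"
| CondFalse: "val a s = Leaf \<Longrightarrow> exec d s n s' \<Longrightarrow> exec (Cond a c d) s (1 + cost a s + n) s'"
| WhileFalse: "val a s = Leaf \<Longrightarrow> exec (While a c) s (1 + cost a s) s"
| WhileTrue: "val a s \<noteq> Leaf \<Longrightarrow> exec c s m s' \<Longrightarrow> exec (While a c) s' n s'' \<Longrightarrow>
    exec (While a c) s (1 + cost a s + m + n) s''"

text \<open>A computational problem is a set of pairs of a (legal) input and the set of its correct
  outputs. Input and output are passed in variable 0.\<close>

type_synonym problem = "(tree \<times> tree set) set"

definition solvable_in_polynomial_time :: "problem \<Rightarrow> bool" where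
  "solvable_in_polynomial_time P \<longleftrightarrow>
     (\<exists>(c :: com) (q :: nat poly). \<forall>(t, R) \<in> P.
        \<exists>n s. exec c ((\<lambda>_. Leaf)(0 := t)) n s \<and> n \<le> poly q (size t) \<and> s 0 \<in> R)"


section \<open>Edge-based districting\<close>

text \<open>
  The graph is finite and simple; an edge is the set of its two endpoints. Districts are
  \<open>1, \<dots>, ndist\<close>. Only the values of \<open>weight\<close> on \<open>edges\<close> and of \<open>center\<close> on \<open>{1..ndist}\<close> matter.
\<close>

record inst =
  verts :: "nat set"
  edges :: "nat set set"
  ndist :: nat
  weight :: "nat set \<Rightarrow> real"
  lower :: real
  upper :: real
  center :: "nat \<Rightarrow> nat"

text \<open>The groups B, C, I, N, O, W, in this order.\<close>

datatype group = Balance | Contiguity | Integrality | CenterSelection | Compactness | Weights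

definition mean_weight :: "inst \<Rightarrow> real" where
  "mean_weight G = (\<Sum>e\<in>edges G. weight G e) / real (ndist G)"

definition is_instance :: "group set \<Rightarrow> inst \<Rightarrow> bool" where
  "is_instance X G \<longleftrightarrow>
     finite (verts G) \<and>
     (\<forall>e\<in>edges G. e \<subseteq> verts G \<and> card e = 2) \<and>
     1 \<le> ndist G \<and> ndist G \<le> card (edges G) \<and>
     (\<forall>e\<in>edges G. 0 < weight G e) \<and>
     lower G \<le> mean_weight G \<and> mean_weight G \<le> upper G \<and>
     (CenterSelection \<notin> X \<longrightarrow> (\<forall>i\<in>{1..ndist G}. center G i \<in> verts G)) \<and>
     (Weights \<notin> X \<longrightarrow> (\<forall>e\<in>edges G. weight G e = 1))"

definition walks :: "inst \<Rightarrow> nat \<Rightarrow> nat \<Rightarrow> nat list set" where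
  "walks G u v = {vs. vs \<noteq> [] \<and> hd vs = u \<and> last vs = v \<and>
     (\<forall>k < length vs - 1. {vs ! k, vs ! Suc k} \<in> edges G)}"

definition walk_length :: "inst \<Rightarrow> nat list \<Rightarrow> real" where
  "walk_length G vs = (\<Sum>k < length vs - 1. weight G {vs ! k, vs ! Suc k})"

text \<open>The distance is \<open>\<infinity>\<close> between different components of the graph.\<close>

definition distance :: "inst \<Rightarrow> nat \<Rightarrow> nat \<Rightarrow> ereal" where
  "distance G u v = (INF vs \<in> walks G u v. ereal (walk_length G vs))"

definition edge_distance :: "real \<Rightarrow> inst \<Rightarrow> nat \<Rightarrow> nat set \<Rightarrow> ereal" where
  "edge_distance \<alpha> G v e = Min (distance G v ` e) + ereal (\<alpha> * weight G e)"

definition verts_of :: "nat set set \<Rightarrow> nat set" where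
  "verts_of D = \<Union> D"

definition boundary :: "inst \<Rightarrow> nat set set \<Rightarrow> nat set set" where
  "boundary G D = {e \<in> edges G - D. e \<inter> verts_of D \<noteq> {}}"

type_synonym alloc = "nat \<Rightarrow> nat set \<Rightarrow> real"
type_synonym centers = "nat \<Rightarrow> nat \<Rightarrow> real"

definition structural :: "inst \<Rightarrow> alloc \<Rightarrow> centers \<Rightarrow> bool" where
  "structural G x w \<longleftrightarrow>
     (\<forall>e\<in>edges G. (\<Sum>i=1..ndist G. x i e) = 1) \<and>
     (\<forall>i\<in>{1..ndist G}. (\<Sum>v\<in>verts G. w i v) = 1) \<and>
     (\<forall>i\<in>{1..ndist G}. \<forall>e\<in>edges G. 0 \<le> x i e) \<and>
     (\<forall>i\<in>{1..ndist G}. \<forall>v\<in>verts G. w i v \<in> {0, 1})"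

definition balanced :: "inst \<Rightarrow> alloc \<Rightarrow> bool" where
  "balanced G x \<longleftrightarrow> (\<forall>i\<in>{1..ndist G}.
     lower G \<le> (\<Sum>e\<in>edges G. weight G e * x i e) \<and>
     (\<Sum>e\<in>edges G. weight G e * x i e) \<le> upper G)"

text \<open>For \<open>D = {}\<close> the inequality would read \<open>0 \<ge> 1\<close>, so it is imposed for nonempty \<open>D\<close> only.\<close>

definition contiguous :: "inst \<Rightarrow> alloc \<Rightarrow> centers \<Rightarrow> bool" where
  "contiguous G x w \<longleftrightarrow> (\<forall>D. D \<subseteq> edges G \<and> D \<noteq> {} \<longrightarrow> (\<forall>i\<in>{1..ndist G}.
     (\<Sum>e\<in>boundary G D. x i e) + (\<Sum>e\<in>D. 1 - x i e) + (\<Sum>v\<in>verts_of D. w i v) \<ge> 1))"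

definition integral_alloc :: "inst \<Rightarrow> alloc \<Rightarrow> bool" where
  "integral_alloc G x \<longleftrightarrow> (\<forall>i\<in>{1..ndist G}. \<forall>e\<in>edges G. x i e \<in> {0, 1})"

definition fractional_alloc :: "inst \<Rightarrow> alloc \<Rightarrow> bool" where
  "fractional_alloc G x \<longleftrightarrow> (\<forall>i\<in>{1..ndist G}. \<forall>e\<in>edges G. x i e \<in> {0..1})"

definition centers_fixed :: "inst \<Rightarrow> centers \<Rightarrow> bool" where
  "centers_fixed G w \<longleftrightarrow>
     (\<forall>i\<in>{1..ndist G}. \<forall>v\<in>verts G. w i v = (if v = center G i then 1 else 0))"

definition feasible :: "group set \<Rightarrow> inst \<Rightarrow> alloc \<Rightarrow> centers \<Rightarrow> bool" where
  "feasible X G x w \<longleftrightarrow>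
     structural G x w \<and>
     (Balance \<in> X \<longrightarrow> balanced G x) \<and>
     (Contiguity \<in> X \<longrightarrow> contiguous G x w) \<and>
     (if Integrality \<in> X then integral_alloc G x else fractional_alloc G x) \<and>
     (CenterSelection \<notin> X \<longrightarrow> centers_fixed G w)"

text \<open>In \<^typ>\<open>ereal\<close>, \<open>0 * \<infinity> = 0\<close>: pairs with \<open>w i v = 0\<close> or \<open>x i e = 0\<close> contribute nothing.\<close>

definition objective :: "real \<Rightarrow> group set \<Rightarrow> inst \<Rightarrow> alloc \<Rightarrow> centers \<Rightarrow> ereal" where
  "objective \<alpha> X G x w =
     (if Compactness \<in> X
      then \<Sum>v\<in>verts G. \<Sum>i=1..ndist G. \<Sum>e\<in>edges G.
             ereal (w i v) * edge_distance \<alpha> G v e * ereal (x i e)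
      else 0)"

definition optimal :: "real \<Rightarrow> group set \<Rightarrow> inst \<Rightarrow> alloc \<Rightarrow> centers \<Rightarrow> bool" where
  "optimal \<alpha> X G x w \<longleftrightarrow> feasible X G x w \<and>
     (\<forall>x' w'. feasible X G x' w' \<longrightarrow> objective \<alpha> X G x w \<le> objective \<alpha> X G x' w')"


section \<open>Encoding of inputs and outputs\<close>

text \<open>Numbers are in binary, least significant bit first.\<close>

definition enc_bool :: "bool \<Rightarrow> tree" where
  "enc_bool b = (if b then Node Leaf Leaf else Leaf)"

fun enc_nat :: "nat \<Rightarrow> tree" where
  "enc_nat 0 = Leaf"
| "enc_nat (Suc n) = Node (enc_bool (odd (Suc n))) (enc_nat (Suc n div 2))"

definition enc_int :: "int \<Rightarrow> tree" where
  "enc_int k = Node (enc_bool (k < 0)) (enc_nat (nat \<bar>k\<bar>))"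

definition enc_rat :: "rat \<Rightarrow> tree" where
  "enc_rat q = (case quotient_of q of (a, b) \<Rightarrow> Node (enc_int a) (enc_nat (nat b)))"

text \<open>Meaningful for rational arguments only.\<close>

definition enc_real :: "real \<Rightarrow> tree" where
  "enc_real r = enc_rat (THE q. of_rat q = r)"

definition enc_list :: "('a \<Rightarrow> tree) \<Rightarrow> 'a list \<Rightarrow> tree" where
  "enc_list f xs = foldr (\<lambda>a t. Node (f a) t) xs Leaf"

definition edge_of :: "nat \<times> nat \<Rightarrow> nat set" where
  "edge_of a = {fst a, snd a}"

text \<open>The vertices and edges may be listed in any order, and so may the endpoints of each edge.\<close>

definition lists_graph :: "nat list \<Rightarrow> (nat \<times> nat) list \<Rightarrow> inst \<Rightarrow> bool" where
  "lists_graph vs es G \<longleftrightarrow>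
     distinct vs \<and> set vs = verts G \<and>
     distinct (map edge_of es) \<and> set (map edge_of es) = edges G"

definition rational_data :: "inst \<Rightarrow> bool" where
  "rational_data G \<longleftrightarrow> lower G \<in> \<rat> \<and> upper G \<in> \<rat> \<and> (\<forall>e\<in>edges G. weight G e \<in> \<rat>)"

text \<open>Weights and centers are part of the input only where they are not determined by, or chosen
  in, the problem variant.\<close>

definition enc_input :: "group set \<Rightarrow> nat list \<Rightarrow> (nat \<times> nat) list \<Rightarrow> inst \<Rightarrow> tree" where
  "enc_input X vs es G = enc_list id
     [enc_list enc_nat vs,
      enc_list (\<lambda>(u, v). Node (enc_nat u) (enc_nat v)) es,
      enc_nat (ndist G),
      if Weights \<in> X then enc_list (\<lambda>a. enc_real (weight G (edge_of a))) es else Leaf,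
      enc_real (lower G),
      enc_real (upper G),
      if CenterSelection \<in> X then Leaf
      else enc_list (\<lambda>i. enc_nat (center G i)) [1..<Suc (ndist G)]]"

definition rational_solution :: "inst \<Rightarrow> alloc \<Rightarrow> bool" where
  "rational_solution G x \<longleftrightarrow> (\<forall>i\<in>{1..ndist G}. \<forall>e\<in>edges G. x i e \<in> \<rat>)"

definition enc_solution ::
  "group set \<Rightarrow> nat list \<Rightarrow> (nat \<times> nat) list \<Rightarrow> inst \<Rightarrow> alloc \<Rightarrow> centers \<Rightarrow> tree" where
  "enc_solution X vs es G x w = Node
     (enc_list (\<lambda>i. enc_list (\<lambda>a. enc_real (x i (edge_of a))) es) [1..<Suc (ndist G)])
     (if CenterSelection \<in> X
      then enc_list (\<lambda>i. enc_list (\<lambda>v. enc_real (w i v)) vs) [1..<Suc (ndist G)]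
      else Leaf)"

text \<open>The output \<^term>\<open>Leaf\<close> reports infeasibility; the encoding of a solution is never a leaf.\<close>

definition correct_outputs ::
  "real \<Rightarrow> group set \<Rightarrow> nat list \<Rightarrow> (nat \<times> nat) list \<Rightarrow> inst \<Rightarrow> tree set" where
  "correct_outputs \<alpha> X vs es G =
     (if \<exists>x w. feasible X G x w
      then {enc_solution X vs es G x w | x w. optimal \<alpha> X G x w \<and> rational_solution G x}
      else {Leaf})"

definition theta :: "real \<Rightarrow> group set \<Rightarrow> problem" where
  "theta \<alpha> X = {(enc_input X vs es G, correct_outputs \<alpha> X vs es G) | vs es G.
     is_instance X G \<and> rational_data G \<and> lists_graph vs es G}"

end

theory Submission
  imports Defs "HOL-Library.More_List"
begin

text \<open>
  Split every district \<open>d\<close> into the slots \<open>(d, 0), \<dots>, (d, m - 1)\<close>, where \<open>m\<close> is the number of edges, and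
  assign the edges injectively to slots. Putting an edge into a slot of \<open>d\<close> costs its (unweighted)
  distance to the center of \<open>d\<close>, or a large number if this distance is infinite. Slots with
  \<open>k \<ge> lower\<close> carry a dominating extra cost, and slots with \<open>k + 1 > upper\<close> a further one, so that a
  cheapest assignment fills the other slots first and respects the balance constraints whenever this is
  possible at all. As \<open>\<alpha>\<close> contributes the constant \<open>\<alpha> m\<close> to the objective, this solves the problem.

  All costs are polynomially bounded integers. Hence they can be written in unary, and Bertsekas'
  auction algorithm with bidding increment 1 takes polynomially many steps. It is optimal
  up to \<open>m\<close>, and therefore exact after multiplying the costs by \<open>m + 1\<close>.

  The time bound is compositional: the functions computed by polynomial-time programs of the machine
  model are closed under pairing, composition, case distinction, and folding over a list as long as the
  accumulator stays polynomially bounded. So the algorithm can be written as an ordinary functional program.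
\<close>

section \<open>Polynomial-time functions on encodable types\<close>

text \<open>The constants create three levels. A finite distance is below \<open>length vs\<close>;
  an infinite one counts as \<open>m * length vs + 1\<close>, more than all finite ones of an
  assignment together; and one unit of penalty outweighs all these costs together. So one assignment
  problem decides balance first, then finiteness of the objective, then its value. Infeasibility
  needs no separate certificate: a feasible allocation would attain the least penalty, so an optimal
  assignment that leaves a mandatory slot empty or uses an absent one excludes it.

  What shapes the programs is that every tree is paid for in full. Unary versions of the binary
  input numbers could be exponentially large and are never formed: vertices are only tested for
  equality, the number of districts is read off the list of centers, and the bounds are only
  compared with numbers up to \<open>m\<close>. The only loop is a fold over a list computed
  beforehand. Hence breadth-first search and the auction run for a precomputed number of rounds,
  which calls for explicit bounds on the rounds that they need.\<close>

class encodable =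
  fixes encode :: "'a \<Rightarrow> tree"

abbreviation esize :: "'a::encodable \<Rightarrow> nat" where
  "esize a \<equiv> size (encode a)"

instantiation tree :: encodable
begin
definition encode_tree :: "tree \<Rightarrow> tree" where [simp]: "encode_tree t = t"
instance ..
end

instantiation unit :: encodable
begin
definition encode_unit :: "unit \<Rightarrow> tree" where [simp]: "encode_unit u = Leaf"
instance ..
end

instantiation bool :: encodable
begin
definition encode_bool :: "bool \<Rightarrow> tree" where "encode_bool = enc_bool"
instance ..
end

text \<open>Unary; the binary numbers of the input are treated as lists of bits.\<close>

instantiation nat :: encodable
begin
definition encode_nat :: "nat \<Rightarrow> tree" where "encode_nat n = (Node Leaf ^^ n) Leaf"
instance ..
end

instantiation prod :: (encodable, encodable) encodable
begin
definition encode_prod :: "'a \<times> 'b \<Rightarrow> tree" where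
  "encode_prod p = Node (encode (fst p)) (encode (snd p))"
instance ..
end

instantiation list :: (encodable) encodable
begin
definition encode_list :: "'a list \<Rightarrow> tree" where "encode_list = enc_list encode"
instance ..
end

lemma encode_Pair [simp]: "encode (a, b) = Node (encode a) (encode b)"
  by (simp add: encode_prod_def)

lemma encode_Nil [simp]: "encode [] = Leaf"
  and encode_Cons [simp]: "encode (x # xs) = Node (encode x) (encode xs)"
  by (simp_all add: encode_list_def enc_list_def)

lemma encode_True [simp]: "encode True = Node Leaf Leaf"
  and encode_False [simp]: "encode False = Leaf"
  by (simp_all add: encode_bool_def enc_bool_def)

lemma encode_0 [simp]: "encode (0::nat) = Leaf"
  and encode_Suc [simp]: "encode (Suc n) = Node Leaf (encode n)"
  by (simp_all add: encode_nat_def)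

lemma esize_nat [simp]: "esize (n::nat) = n"
  by (induction n) simp_all

lemma encode_neq_Leaf [simp]:
  "encode b \<noteq> Leaf \<longleftrightarrow> b"
  "encode xs \<noteq> Leaf \<longleftrightarrow> xs \<noteq> []"
  "encode b = Leaf \<longleftrightarrow> \<not> b"
  "encode xs = Leaf \<longleftrightarrow> xs = []"
proof -
  show "encode b \<noteq> Leaf \<longleftrightarrow> b" "encode b = Leaf \<longleftrightarrow> \<not> b" by (cases b; simp)+
  show "encode xs \<noteq> Leaf \<longleftrightarrow> xs \<noteq> []" "encode xs = Leaf \<longleftrightarrow> xs = []" by (cases xs; simp)+
qed

lemma length_le_esize: "length xs \<le> esize xs"
  by (induction xs) simp_all

lemma esize_mem: "x \<in> set xs \<Longrightarrow> esize x < esize xs"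
  by (induction xs) auto

lemma esize_append [simp]: "esize (xs @ ys) = esize xs + esize ys"
  by (induction xs) simp_all

lemma esize_filter: "esize (filter P xs) \<le> esize xs"
  by (induction xs) auto

lemma esize_tl: "esize (tl xs) \<le> esize xs"
  by (cases xs) auto

subsection \<open>Runs with a time bound\<close>

text \<open>\<open>exec\<close> fixes the exact time. An upper bound can be weakened, so that one
  formula covers all branches of a program.\<close>

definition runs :: "com \<Rightarrow> state \<Rightarrow> state \<Rightarrow> nat \<Rightarrow> bool" where
  "runs c s s' b \<longleftrightarrow> (\<exists>n\<le>b. exec c s n s')"

lemma runs_Assign: "s' = s(i := val a s) \<Longrightarrow> 1 + cost a s \<le> b \<Longrightarrow> runs (Assign i a) s s' b"
  unfolding runs_def using exec.Assign by blast

lemma runs_Seq: "runs c s s' a \<Longrightarrow> runs d s' s'' b \<Longrightarrow> runs (Seq c d) s s'' (1 + a + b)"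
  unfolding runs_def by (meson exec.Seq add_mono le_refl)

lemma runs_CondTrue:
  "val a s \<noteq> Leaf \<Longrightarrow> runs c s s' b \<Longrightarrow> runs (Cond a c d) s s' (1 + cost a s + b)"
  unfolding runs_def by (meson exec.CondTrue add_mono le_refl)

lemma runs_CondFalse:
  "val a s = Leaf \<Longrightarrow> runs d s s' b \<Longrightarrow> runs (Cond a c d) s s' (1 + cost a s + b)"
  unfolding runs_def by (meson exec.CondFalse add_mono le_refl)

lemma runs_WhileFalse: "val a s = Leaf \<Longrightarrow> runs (While a c) s s (1 + cost a s)"
  unfolding runs_def using exec.WhileFalse by blast

lemma runs_WhileTrue:
  "val a s \<noteq> Leaf \<Longrightarrow> runs c s s' b \<Longrightarrow> runs (While a c) s' s'' d \<Longrightarrow>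
    runs (While a c) s s'' (1 + cost a s + b + d)"
  unfolding runs_def by (meson exec.WhileTrue add_mono le_refl)

lemma runs_mono: "runs c s s' b \<Longrightarrow> b \<le> b' \<Longrightarrow> runs c s s' b'"
  unfolding runs_def using order_trans by blast

lemma size_val_le_cost: "size (val a s) \<le> cost a s"
  by (induction a) auto

text \<open>A value has to be paid for by its size before it is stored, so no variable outgrows the
  elapsed time.\<close>

lemma exec_size: "exec c s n s' \<Longrightarrow> size (s' i) \<le> size (s i) + n"
proof (induction arbitrary: i rule: exec.induct)
  case (Assign j a s)
  then show ?case using size_val_le_cost[of a s] by (auto intro: order_trans)
next
  case (Seq c s m s' d n s'')
  then show ?case using Seq.IH[of i] by linarith
next
  case (WhileTrue a s c m s' n s'')
  then show ?case using WhileTrue.IH[of i] by linarith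
next
  case (CondTrue a s c n s' d)
  then show ?case using CondTrue.IH[of i] by linarith
next
  case (CondFalse a s d n s' c)
  then show ?case using CondFalse.IH[of i] by linarith
qed auto

lemma runs_size: "runs c s s' b \<Longrightarrow> size (s' i) \<le> size (s i) + b"
  unfolding runs_def using exec_size by (meson add_left_mono order_trans)

subsection \<open>Polynomial size bounds\<close>

text \<open>Natural coefficients make polynomials monotone. This is what lets size bounds be
  composed in \<open>psize_comp\<close>, where the bounded function itself need not be
  monotone.\<close>

lemma poly_nat_mono: "m \<le> n \<Longrightarrow> poly p m \<le> poly p n" for p :: "nat poly"
  by (induction p) (auto intro!: add_mono mult_mono)

definition psize :: "('a::encodable \<Rightarrow> nat) \<Rightarrow> bool" where
  "psize h \<longleftrightarrow> (\<exists>p. \<forall>a. h a \<le> poly p (esize a))"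

named_theorems psize_intros

lemma psizeI: "(\<And>a. h a \<le> poly p (esize a)) \<Longrightarrow> psize h"
  unfolding psize_def by blast

lemma psize_le: "psize h \<Longrightarrow> (\<And>a. g a \<le> h a) \<Longrightarrow> psize g"
  unfolding psize_def using order_trans by blast

lemma psize_const [psize_intros]: "psize (\<lambda>a. n)"
  by (rule psizeI[of _ "[:n:]"]) simp

lemma psize_esize [psize_intros]: "psize esize"
  by (rule psizeI[of _ "[:0, 1:]"]) simp

lemma psize_add [psize_intros]:
  assumes "psize g" "psize h" shows "psize (\<lambda>a. g a + h a)"
proof -
  obtain p q where "\<And>a. g a \<le> poly p (esize a)" "\<And>a. h a \<le> poly q (esize a)"
    using assms unfolding psize_def by blast
  then show ?thesis by (intro psizeI[of _ "p + q"]) (simp add: add_mono)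
qed

lemma psize_mult [psize_intros]:
  assumes "psize g" "psize h" shows "psize (\<lambda>a. g a * h a)"
proof -
  obtain p q where "\<And>a. g a \<le> poly p (esize a)" "\<And>a. h a \<le> poly q (esize a)"
    using assms unfolding psize_def by blast
  then show ?thesis by (intro psizeI[of _ "p * q"]) (simp add: mult_mono)
qed

lemma psize_Suc [psize_intros]: "psize h \<Longrightarrow> psize (\<lambda>a. Suc (h a))"
  using psize_add[OF _ psize_const[of 1]] by simp

lemma psize_poly:
  assumes "psize h" shows "psize (\<lambda>a. poly p (h a))"
proof -
  obtain q where "\<And>a. h a \<le> poly q (esize a)"
    using assms unfolding psize_def by blast
  then show ?thesis
    by (intro psizeI[of _ "pcompose p q"]) (auto simp: poly_pcompose intro: poly_nat_mono)
qed

lemma psize_comp: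
  fixes f :: "'a::encodable \<Rightarrow> 'b::encodable"
  assumes "psize h" "psize (\<lambda>a. esize (f a))" shows "psize (\<lambda>a. h (f a))"
proof -
  obtain q where q: "\<And>a. h a \<le> poly q (esize a)"
    using assms(1) unfolding psize_def by blast
  show ?thesis
    by (rule psize_le[OF psize_poly[OF assms(2), of q]]) (rule q)
qed

subsection \<open>Closure properties\<close>

text \<open>The program may use all variables below \<open>k\<close>, whose initial values are arbitrary, and leaves
  the others alone; so programs can be composed without interference.\<close>

definition realizes :: "com \<Rightarrow> nat \<Rightarrow> ('a::encodable \<Rightarrow> nat) \<Rightarrow> ('a \<Rightarrow> 'b::encodable) \<Rightarrow> bool" where
  "realizes c k b f \<longleftrightarrow> (\<forall>a s. s 0 = encode a \<longrightarrow>
     (\<exists>s'. runs c s s' (b a) \<and> s' 0 = encode (f a) \<and> (\<forall>j\<ge>k. s' j = s j)))"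

text \<open>The bound is a function of the argument rather than of its size, so that closure proofs
  can write down terms such as \<open>b' (f a)\<close>; \<open>psize\<close> supplies the
  polynomial.\<close>

definition ptime :: "('a::encodable \<Rightarrow> 'b::encodable) \<Rightarrow> bool" where
  "ptime f \<longleftrightarrow> (\<exists>c k b. psize b \<and> realizes c k b f)"

named_theorems ptime_intros

lemma realizesE:
  assumes "realizes c k b f" "s 0 = encode a"
  obtains s' where "runs c s s' (b a)" "s' 0 = encode (f a)" "\<And>j. k \<le> j \<Longrightarrow> s' j = s j"
  using assms unfolding realizes_def by blast

lemma ptimeI: "psize b \<Longrightarrow> realizes c k b f \<Longrightarrow> ptime f"
  unfolding ptime_def by blast

text \<open>Programs see encodings only, so operations on different types may share one program:
  \<open>Cons\<close> is pairing, and \<open>Suc\<close> is pairing with \<open>()\<close>.\<close>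

lemma ptime_recode:
  assumes "ptime f" "\<And>a. encode (g a) = encode (f a)"
  shows "ptime g"
  using assms unfolding ptime_def realizes_def by simp

lemma ptime_expI:
  fixes f :: "'a::encodable \<Rightarrow> 'b::encodable" and b :: "'a \<Rightarrow> nat"
  assumes "\<And>a s. s 0 = encode a \<Longrightarrow> val x s = encode (f a)"
    and "\<And>a s. s 0 = encode a \<Longrightarrow> cost x s \<le> b a" and "psize b"
  shows "ptime f"
proof (rule ptimeI)
  show "psize (\<lambda>a. 1 + b a)" by (intro psize_intros assms)
  show "realizes (Assign 0 x) 1 (\<lambda>a. 1 + b a) f"
    unfolding realizes_def
  proof (intro allI impI)
    fix a :: 'a and s :: state assume s: "s 0 = encode a"
    show "\<exists>s'. runs (Assign 0 x) s s' (1 + b a) \<and> s' 0 = encode (f a) \<and> (\<forall>j\<ge>1. s' j = s j)"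
      by (intro exI[of _ "s(0 := val x s)"] conjI runs_Assign) (auto simp: assms s)
  qed
qed

text \<open>By \<open>exec_size\<close>, the output exceeds the input by at most the running time.
  This yields the size of the intermediate result in a composition.\<close>

lemma psize_ptime:
  assumes "ptime f" shows "psize (\<lambda>a. esize (f a))"
proof -
  obtain c k b where b: "psize b" and r: "realizes c k b f"
    using assms unfolding ptime_def by blast
  have "esize (f a) \<le> esize a + b a" for a
    using realizesE[OF r, of "\<lambda>_. encode a" a] runs_size[of c "\<lambda>_. encode a" _ _ 0] by metis
  moreover have "psize (\<lambda>a. esize a + b a)" by (intro psize_intros b)
  ultimately show ?thesis by (rule psize_le[rotated])
qed

lemma psize_ptime_nat: "ptime f \<Longrightarrow> psize f" for f :: "_ \<Rightarrow> nat"
  using psize_ptime[of f] by simp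

lemma ptime_id [ptime_intros]: "ptime (\<lambda>a. a)"
  by (rule ptime_expI[of "Var 0" _ "\<lambda>a. 1 + esize a"]) (auto intro!: psize_intros)

lemma ptime_comp:
  fixes f :: "'a::encodable \<Rightarrow> 'b::encodable" and g :: "'b \<Rightarrow> 'c::encodable"
  assumes f: "ptime f" and g: "ptime g" shows "ptime (\<lambda>a. g (f a))"
proof -
  obtain c k b where b: "psize b" and c: "realizes c k b f"
    using f unfolding ptime_def by blast
  obtain c' k' b' where b': "psize b'" and c': "realizes c' k' b' g"
    using g unfolding ptime_def by blast
  show ?thesis
  proof (rule ptimeI)
    show "psize (\<lambda>a. 1 + b a + b' (f a))"
      by (intro psize_intros b psize_comp[OF b'] psize_ptime[OF f])
    show "realizes (Seq c c') (k + k') (\<lambda>a. 1 + b a + b' (f a)) (\<lambda>a. g (f a))"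
      unfolding realizes_def
    proof (intro allI impI)
      fix a :: 'a and s :: state assume "s 0 = encode a"
      from realizesE[of c k b f s a, OF c this] obtain s1 where
        1: "runs c s s1 (b a)" "s1 0 = encode (f a)" "\<And>j. k \<le> j \<Longrightarrow> s1 j = s j" by metis
      from realizesE[of c' k' b' g s1 "f a", OF c' this(2)] obtain s2 where
        2: "runs c' s1 s2 (b' (f a))" "s2 0 = encode (g (f a))" "\<And>j. k' \<le> j \<Longrightarrow> s2 j = s1 j" by metis
      show "\<exists>s'. runs (Seq c c') s s' (1 + b a + b' (f a)) \<and> s' 0 = encode (g (f a)) \<and>
          (\<forall>j\<ge>k + k'. s' j = s j)"
        using runs_Seq[OF 1(1) 2(1)] 1 2 by auto
    qed
  qed
qed

lemma ptime_fst [ptime_intros]: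
  assumes "ptime f" shows "ptime (\<lambda>a. fst (f a))"
proof (rule ptime_comp[OF assms])
  show "ptime (fst :: 'b \<times> 'c \<Rightarrow> 'b)"
    by (rule ptime_expI[of "LeftE (Var 0)" _ "\<lambda>a. 2 + esize a + esize a"])
      (auto intro!: psize_intros)
qed

lemma ptime_snd [ptime_intros]:
  assumes "ptime f" shows "ptime (\<lambda>a. snd (f a))"
proof (rule ptime_comp[OF assms])
  show "ptime (snd :: 'b \<times> 'c \<Rightarrow> 'c)"
    by (rule ptime_expI[of "RightE (Var 0)" _ "\<lambda>a. 2 + esize a + esize a"])
      (auto intro!: psize_intros)
qed

lemma ptime_tl [ptime_intros]:
  assumes "ptime f" shows "ptime (\<lambda>a. tl (f a))"
proof (rule ptime_comp[OF assms], rule ptime_expI)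
  fix xs :: "'b list" and s :: state
  assume "s 0 = encode xs"
  then show "val (RightE (Var 0)) s = encode (tl xs)"
    and "cost (RightE (Var 0)) s \<le> 2 + esize xs + esize xs"
    by (cases xs, simp, simp)+
qed (intro psize_intros)

lemma ptime_const [ptime_intros]: "ptime (\<lambda>a. b)"
proof -
  define x where "x = rec_tree LeafE (\<lambda>_ _. NodeE)"
  have "val (x t) s = t" for t s
    by (induction t) (auto simp: x_def)
  moreover have "cost (x t) s = cost (x t) (\<lambda>_. Leaf)" for t s
    using calculation by (induction t) (auto simp: x_def)
  ultimately show ?thesis
    by (intro ptime_expI[of "x (encode b)" _ "\<lambda>_. cost (x (encode b)) (\<lambda>_. Leaf)"])
      (auto intro!: psize_intros simp: order_eq_refl)
qed

lemma ptime_Pair [ptime_intros]: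
  fixes f :: "'a::encodable \<Rightarrow> 'b::encodable" and g :: "'a \<Rightarrow> 'c::encodable"
  assumes f: "ptime f" and g: "ptime g" shows "ptime (\<lambda>a. (f a, g a))"
proof -
  obtain c k b where b: "psize b" and c: "realizes c k b f"
    using f unfolding ptime_def by blast
  obtain c' k' b' where b': "psize b'" and c': "realizes c' k' b' g"
    using g unfolding ptime_def by blast
  \<comment> \<open>Variables \<open>K\<close> and \<open>Suc K\<close> are out of reach of both
    programs, and the \<open>Suc\<close> here keeps them apart from variable 0. The first saves the
    input for the second program, the other the first result.\<close>
  define K where "K = Suc (k + k')"
  define p where "p = Seq (Assign K (Var 0)) (Seq c (Seq (Assign (Suc K) (Var 0))
      (Seq (Assign 0 (Var K)) (Seq c' (Assign 0 (NodeE (Var (Suc K)) (Var 0)))))))"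
  define B where "B = (\<lambda>a. 20 + 3 * esize a + b a + b' a + 4 * esize (f a) + 4 * esize (g a))"
  show ?thesis
  proof (rule ptimeI)
    show "psize B"
      unfolding B_def by (intro psize_intros b b' psize_ptime[OF f] psize_ptime[OF g])
    show "realizes p (Suc (Suc K)) B (\<lambda>a. (f a, g a))"
      unfolding realizes_def
    proof (intro allI impI)
      fix a :: 'a and s :: state assume s: "s 0 = encode a"
      have "(s(K := s 0)) 0 = encode a" by (simp add: s K_def)
      from realizesE[of c k b f "s(K := s 0)" a, OF c this] obtain s1 where
        1: "runs c (s(K := s 0)) s1 (b a)" "s1 0 = encode (f a)" "\<And>j. k \<le> j \<Longrightarrow> s1 j = (s(K := s 0)) j"
        by metis
      define s2 where "s2 = s1(Suc K := encode (f a), 0 := encode a)"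
      have "s2 0 = encode a" by (simp add: s2_def)
      from realizesE[of c' k' b' g s2 a, OF c' this] obtain s3 where
        3: "runs c' s2 s3 (b' a)" "s3 0 = encode (g a)" "\<And>j. k' \<le> j \<Longrightarrow> s3 j = s2 j" by metis
      define s4 where "s4 = s3(0 := Node (encode (f a)) (encode (g a)))"
      have "runs p s s4 (1 + (2 + esize a) + (1 + b a + (1 + (2 + esize (f a)) +
              (1 + (2 + esize a) + (1 + b' a + (5 + 2 * esize (f a) + 2 * esize (g a)))))))"
        unfolding p_def
      proof (intro runs_Seq)
        show "runs (Assign K (Var 0)) s (s(K := s 0)) (2 + esize a)"
          by (rule runs_Assign) (auto simp: s)
        show "runs c (s(K := s 0)) s1 (b a)" by fact
        show "runs (Assign (Suc K) (Var 0)) s1 (s1(Suc K := s1 0)) (2 + esize (f a))"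
          by (rule runs_Assign) (auto simp: 1)
        show "runs (Assign 0 (Var K)) (s1(Suc K := s1 0)) s2 (2 + esize a)"
          by (rule runs_Assign) (auto simp: 1 s2_def s K_def)
        show "runs c' s2 s3 (b' a)" by fact
        show "runs (Assign 0 (NodeE (Var (Suc K)) (Var 0))) s3 s4 (5 + 2 * esize (f a) + 2 * esize (g a))"
          by (rule runs_Assign) (auto simp: 3 s2_def s4_def K_def)
      qed
      then have "runs p s s4 (B a)"
        by (rule runs_mono) (simp add: B_def)
      moreover have "s4 0 = encode (f a, g a)" by (simp add: s4_def)
      moreover have "\<forall>j\<ge>Suc (Suc K). s4 j = s j"
        by (auto simp: s4_def 3 s2_def 1 K_def)
      ultimately show "\<exists>s'. runs p s s' (B a) \<and> s' 0 = encode (f a, g a) \<and> (\<forall>j\<ge>Suc (Suc K). s' j = s j)"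
        by blast
    qed
  qed
qed

lemma ptime_Cons [ptime_intros]: "ptime f \<Longrightarrow> ptime g \<Longrightarrow> ptime (\<lambda>a. f a # g a)"
  by (rule ptime_recode[OF ptime_Pair[of f g]]) simp_all

lemma ptime_Suc [ptime_intros]: "ptime f \<Longrightarrow> ptime (\<lambda>a. Suc (f a))"
  by (rule ptime_recode[OF ptime_Pair[OF ptime_const[of "()"], of f]]) simp_all

lemma ptime_encode [ptime_intros]: "ptime f \<Longrightarrow> ptime (\<lambda>a. encode (f a))"
  by (rule ptime_recode) simp_all

lemma ptime_if [ptime_intros]:
  fixes f :: "'a::encodable \<Rightarrow> 'b::encodable"
  assumes h: "ptime h" and f: "ptime f" and g: "ptime g"
  shows "ptime (\<lambda>a. if h a then f a else g a)"
proof -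
  obtain c k b where b: "psize b" and c: "realizes c k b f"
    using f unfolding ptime_def by blast
  obtain c' k' b' where b': "psize b'" and c': "realizes c' k' b' g"
    using g unfolding ptime_def by blast
  \<comment> \<open>\<open>Cond\<close> tests an expression, whereas \<open>h\<close> takes a
    program to evaluate. So the truth value is first paired with the input, and \<open>F\<close>
    merely branches on it.\<close>
  define F where "F = (\<lambda>x. if fst x then f (snd x) else g (snd x))"
  define p where "p = Cond (LeftE (Var 0)) (Seq (Assign 0 (RightE (Var 0))) c)
    (Seq (Assign 0 (RightE (Var 0))) c')"
  define B where "B = (\<lambda>x :: bool \<times> 'a. 20 + 4 * esize x + b (snd x) + b' (snd x))"
  have "ptime F"
  proof (rule ptimeI)
    have *: "psize (\<lambda>x :: bool \<times> 'a. esize (snd x))"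
      by (intro psize_ptime ptime_intros)
    show "psize B"
      unfolding B_def by (intro psize_intros psize_comp[OF b] psize_comp[OF b'] *)
    show "realizes p (Suc (k + k')) B F"
      unfolding realizes_def
    proof (intro allI impI)
      fix x :: "bool \<times> 'a" and s :: state assume s: "s 0 = encode x"
      obtain t a where x: "x = (t, a)" by (cases x)
      have 0: "(s(0 := encode a)) 0 = encode a" by simp
      have assign: "runs (Assign 0 (RightE (Var 0))) s (s(0 := encode a)) (5 + 2 * esize x)"
        by (rule runs_Assign) (auto simp: s x)
      have cost: "cost (LeftE (Var 0)) s \<le> 5 + 2 * esize x" by (simp add: s x)
      show "\<exists>s'. runs p s s' (B x) \<and> s' 0 = encode (F x) \<and> (\<forall>j\<ge>Suc (k + k'). s' j = s j)"
      proof (cases t)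
        case True
        from realizesE[of c k b f "s(0 := encode a)" a, OF c 0] obtain s1 where
          1: "runs c (s(0 := encode a)) s1 (b a)" "s1 0 = encode (f a)"
             "\<And>j. k \<le> j \<Longrightarrow> s1 j = (s(0 := encode a)) j" by metis
        have "runs p s s1 (1 + cost (LeftE (Var 0)) s + (1 + (5 + 2 * esize x) + b a))"
          unfolding p_def using True by (intro runs_CondTrue runs_Seq[OF assign 1(1)]) (simp add: s x)
        then have "runs p s s1 (B x)"
          by (rule runs_mono) (use cost in \<open>simp add: B_def x\<close>)
        with 1 True show ?thesis by (auto simp: F_def x)
      next
        case False
        from realizesE[of c' k' b' g "s(0 := encode a)" a, OF c' 0] obtain s1 where
          1: "runs c' (s(0 := encode a)) s1 (b' a)" "s1 0 = encode (g a)"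
             "\<And>j. k' \<le> j \<Longrightarrow> s1 j = (s(0 := encode a)) j" by metis
        have "runs p s s1 (1 + cost (LeftE (Var 0)) s + (1 + (5 + 2 * esize x) + b' a))"
          unfolding p_def using False by (intro runs_CondFalse runs_Seq[OF assign 1(1)]) (simp add: s x)
        then have "runs p s s1 (B x)"
          by (rule runs_mono) (use cost in \<open>simp add: B_def x\<close>)
        with 1 False show ?thesis by (auto simp: F_def x)
      qed
    qed
  qed
  from ptime_comp[OF ptime_Pair[OF h ptime_id] this] show ?thesis
    unfolding F_def fst_conv snd_conv .
qed

lemma ptime_not_Nil [ptime_intros]: "ptime f \<Longrightarrow> ptime (\<lambda>a. f a \<noteq> [])"
  for f :: "'a::encodable \<Rightarrow> 'b::encodable list"
proof (erule ptime_comp)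
  define p where "p = Cond (Var 0) (Assign 0 (NodeE LeafE LeafE)) (Assign 0 LeafE)"
  have "realizes p 1 (\<lambda>xs. 20 + esize xs) (\<lambda>xs :: 'b list. xs \<noteq> [])"
    unfolding realizes_def
  proof (intro allI impI)
    fix xs :: "'b list" and s :: state assume s: "s 0 = encode xs"
    define s' where "s' = s(0 := encode (xs \<noteq> []))"
    have "runs p s s' (1 + cost (Var 0) s + 10)"
    proof (cases "xs = []")
      case True
      then show ?thesis unfolding p_def
        by (intro runs_CondFalse runs_Assign) (auto simp: s s'_def)
    next
      case False
      then show ?thesis unfolding p_def
        by (intro runs_CondTrue runs_Assign) (auto simp: s s'_def)
    qed
    then have "runs p s s' (20 + esize xs)" by (rule runs_mono) (simp add: s)
    then show "\<exists>s'. runs p s s' (20 + esize xs) \<and> s' 0 = encode (xs \<noteq> []) \<and> (\<forall>j\<ge>1. s' j = s j)"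
      by (intro exI[of _ s']) (auto simp: s'_def)
  qed
  then show "ptime (\<lambda>xs :: 'b list. xs \<noteq> [])"
    by (rule ptimeI[rotated]) (intro psize_intros)
qed

text \<open>A nonempty list and the pair of its head and tail have the same encoding.\<close>

lemma ptime_case_list [ptime_intros]:
  fixes n :: "'a::encodable \<Rightarrow> 'c::encodable" and l :: "'a \<Rightarrow> 'b::encodable list"
  assumes l: "ptime l" and n: "ptime n"
    and c: "ptime (\<lambda>t. f (fst t) (fst (snd t)) (snd (snd t)))"
  shows "ptime (\<lambda>a. case l a of [] \<Rightarrow> n a | x # xs \<Rightarrow> f a x xs)"
proof -
  define F where "F = (\<lambda>u. case snd u of [] \<Rightarrow> n (fst u) | x # xs \<Rightarrow> f (fst u) x xs)"
  obtain d k b where b: "psize b" and d: "realizes d k b (\<lambda>t. f (fst t) (fst (snd t)) (snd (snd t)))"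
    using c unfolding ptime_def by blast
  obtain d' k' b' where b': "psize b'" and d': "realizes d' k' b' n"
    using n unfolding ptime_def by blast
  define p where "p = Cond (RightE (Var 0)) d (Seq (Assign 0 (LeftE (Var 0))) d')"
  \<comment> \<open>\<open>b\<close> is a function of the triple \<open>(a, x, xs)\<close>, which
    exists in one branch only; a polynomial in the common size of the triple and of
    \<open>(a, x # xs)\<close> makes sense in both.\<close>
  obtain q where q: "\<And>t. b t \<le> poly q (esize t)" using b unfolding psize_def by blast
  define B where "B = (\<lambda>x :: 'a \<times> 'b list. 20 + 4 * esize x + poly q (esize x) + b' (fst x))"
  have "ptime F"
  proof (rule ptimeI)
    have *: "psize (\<lambda>x :: 'a \<times> 'b list. esize (fst x))"
      by (intro psize_ptime ptime_intros)
    show "psize B"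
      unfolding B_def by (intro psize_intros psize_comp[OF b'] * psize_poly)
    show "realizes p (Suc (k + k')) B F"
      unfolding realizes_def
    proof (intro allI impI)
      fix u :: "'a \<times> 'b list" and s :: state assume s: "s 0 = encode u"
      obtain a ys where u: "u = (a, ys)" by (cases u)
      have cost: "cost (RightE (Var 0)) s \<le> 5 + 2 * esize u" by (simp add: s u)
      show "\<exists>s'. runs p s s' (B u) \<and> s' 0 = encode (F u) \<and> (\<forall>j\<ge>Suc (k + k'). s' j = s j)"
      proof (cases ys)
        case (Cons x xs)
        have sx: "s 0 = encode (a, x, xs)" by (simp add: s u Cons)
        from realizesE[of d k b _ s "(a, x, xs)", OF d sx] obtain s1 where
          1: "runs d s s1 (b (a, x, xs))" "s1 0 = encode (f a x xs)"
             "\<And>j. k \<le> j \<Longrightarrow> s1 j = s j" by auto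
        have "runs p s s1 (1 + cost (RightE (Var 0)) s + b (a, x, xs))"
          unfolding p_def by (intro runs_CondTrue 1) (simp add: s u Cons)
        then have "runs p s s1 (B u)"
          by (rule runs_mono) (use cost q[of "(a, x, xs)"] in \<open>simp add: B_def u Cons\<close>)
        with 1 show ?thesis by (auto simp: F_def u Cons)
      next
        case Nil
        have 0: "(s(0 := encode a)) 0 = encode a" by simp
        have assign: "runs (Assign 0 (LeftE (Var 0))) s (s(0 := encode a)) (5 + 2 * esize u)"
          by (rule runs_Assign) (auto simp: s u)
        from realizesE[of d' k' b' n "s(0 := encode a)" a, OF d' 0] obtain s1 where
          1: "runs d' (s(0 := encode a)) s1 (b' a)" "s1 0 = encode (n a)"
             "\<And>j. k' \<le> j \<Longrightarrow> s1 j = (s(0 := encode a)) j" by metis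
        have "runs p s s1 (1 + cost (RightE (Var 0)) s + (1 + (5 + 2 * esize u) + b' a))"
          unfolding p_def by (intro runs_CondFalse runs_Seq[OF assign 1(1)]) (simp add: s u Nil)
        then have "runs p s s1 (B u)"
          by (rule runs_mono) (use cost in \<open>simp add: B_def u\<close>)
        with 1 show ?thesis by (auto simp: F_def u Nil)
      qed
    qed
  qed
  from ptime_comp[OF ptime_Pair[OF ptime_id l] this] show ?thesis
    unfolding F_def fst_conv snd_conv .
qed

lemma ptime_Let [ptime_intros]:
  assumes f: "ptime f" and g: "ptime (\<lambda>t. g (fst t) (snd t))"
  shows "ptime (\<lambda>a. let x = f a in g a x)"
  using ptime_comp[OF ptime_Pair[OF ptime_id f] g] by (simp add: Let_def)

text \<open>A polynomial-time step is not enough: an accumulator that doubles in each round would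
  become exponentially large. So a bound on the accumulator after every prefix of the list is
  demanded.\<close>

lemma ptime_fold_bounded:
  fixes g :: "'a::encodable \<Rightarrow> 'c::encodable \<Rightarrow> 'b::encodable \<Rightarrow> 'b"
  assumes g: "ptime (\<lambda>t. g (fst t) (fst (snd t)) (snd (snd t)))"
    and l: "ptime l" and i: "ptime i"
    and h: "psize h" and bound: "\<And>a n. esize (fold (g a) (take n (l a)) (i a)) \<le> h a"
  shows "ptime (\<lambda>a. fold (g a) (l a) (i a))"
proof -
  obtain cg kg bg where bg: "psize bg"
    and cg: "realizes cg kg bg (\<lambda>t. g (fst t) (fst (snd t)) (snd (snd t)))"
    using g unfolding ptime_def by blast
  obtain cl kl bl where bl: "psize bl" and cl: "realizes cl kl bl l"
    using l unfolding ptime_def by blast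
  obtain ci ki bi where bi: "psize bi" and ci: "realizes ci ki bi i"
    using i unfolding ptime_def by blast
  obtain q where q: "\<And>t. bg t \<le> poly q (esize t)" using bg unfolding psize_def by blast
  \<comment> \<open>Beyond the reach of the three programs, \<open>K\<close> holds the parameter,
    \<open>K + 1\<close> the rest of the list, and \<open>K + 2\<close> the accumulator.\<close>
  define K where "K = Suc (kg + kl + ki)"
  define body where "body = Seq (Assign 0 (NodeE (Var K) (NodeE (LeftE (Var (K + 1))) (Var (K + 2)))))
     (Seq cg (Seq (Assign (K + 2) (Var 0)) (Assign (K + 1) (RightE (Var (K + 1))))))"
  define loop where "loop = While (Var (K + 1)) body"
  define p where "p = Seq (Assign K (Var 0)) (Seq cl (Seq (Assign (K + 1) (Var 0))
    (Seq (Assign 0 (Var K)) (Seq ci (Seq (Assign (K + 2) (Var 0))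
    (Seq loop (Assign 0 (Var (K + 2)))))))))"
  \<comment> \<open>\<open>S\<close> bounds the stored values taken together, and \<open>T\<close>
    the time of one round with its test. The final failing test accounts for the factor
    \<open>Suc (length xs)\<close> below.\<close>
  define S where "S = (\<lambda>a. esize a + esize (l a) + h a)"
  define T where "T = (\<lambda>a. 60 + 10 * S a + poly q (2 + S a))"
  have body: "\<exists>s'. runs body s s' (49 + 9 * S a + poly q (2 + S a)) \<and> s' K = encode a \<and> s' (K + 1) = encode xs \<and>
      s' (K + 2) = encode (g a x y) \<and> (\<forall>j\<ge>K + 3. s' j = s j)"
    if s: "s K = encode a" "s (K + 1) = encode (x # xs)" "s (K + 2) = encode y"
      and le: "esize (x # xs) \<le> esize (l a)" "esize y \<le> h a" "esize (g a x y) \<le> h a"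
    for s x xs and a :: 'a and y :: 'b
  proof -
    define s1 where "s1 = s(0 := encode (a, x, y))"
    have "s1 0 = encode (a, x, y)" by (simp add: s1_def)
    from realizesE[of cg kg bg _ s1 "(a, x, y)", OF cg this] obtain s2 where
      2: "runs cg s1 s2 (bg (a, x, y))" "s2 0 = encode (g a x y)" "\<And>j. kg \<le> j \<Longrightarrow> s2 j = s1 j"
      by auto
    define s3 where "s3 = s2(K + 2 := encode (g a x y), K + 1 := encode xs)"
    have "runs body s s3 (1 + (20 + 5 * S a) + (1 + bg (a, x, y) + (1 + (10 + S a) + (10 + 2 * S a))))"
      unfolding body_def
    proof (intro runs_Seq)
      show "runs (Assign 0 (NodeE (Var K) (NodeE (LeftE (Var (K + 1))) (Var (K + 2))))) s s1 (20 + 5 * S a)"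
        using s le by (intro runs_Assign) (auto simp: s1_def S_def)
      show "runs cg s1 s2 (bg (a, x, y))" by fact
      show "runs (Assign (K + 2) (Var 0)) s2 (s2(K + 2 := s2 0)) (10 + S a)"
        using le by (intro runs_Assign) (auto simp: 2 S_def)
      show "runs (Assign (K + 1) (RightE (Var (K + 1)))) (s2(K + 2 := s2 0)) s3 (10 + 2 * S a)"
        using le s 2 by (intro runs_Assign) (auto simp: 2 S_def s3_def s1_def K_def)
    qed
    moreover have "bg (a, x, y) \<le> poly q (2 + S a)"
      using le by (intro order_trans[OF q] poly_nat_mono) (simp add: S_def)
    ultimately have "runs body s s3 (49 + 9 * S a + poly q (2 + S a))"
      by (auto elim!: runs_mono)
    moreover have "s3 K = encode a" "s3 (K + 1) = encode xs"
      "s3 (K + 2) = encode (g a x y)" "\<forall>j\<ge>K + 3. s3 j = s j"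
      using s by (auto simp: s3_def 2 s1_def K_def)
    ultimately show ?thesis by blast
  qed
  have loop: "\<exists>s'. runs loop s s' (Suc (length xs) * T a) \<and> s' (K + 2) = encode (fold (g a) xs y) \<and>
       (\<forall>j\<ge>K + 3. s' j = s j)"
    if s: "s K = encode a" "s (K + 1) = encode xs" "s (K + 2) = encode y"
      and le: "esize xs \<le> esize (l a)" "\<And>n. esize (fold (g a) (take n xs) y) \<le> h a"
    for s xs and a :: 'a and y :: 'b
    using that
  proof (induction xs arbitrary: y s)
    case Nil
    have "runs loop s s (1 + cost (Var (K + 1)) s)"
      unfolding loop_def using Nil by (intro runs_WhileFalse) simp
    then have "runs loop s s (Suc (length ([]::'c list)) * T a)"
      using Nil by (auto elim!: runs_mono simp: T_def S_def)
    with Nil show ?case by auto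
  next
    case (Cons x xs)
    have "esize y \<le> h a" "esize (g a x y) \<le> h a"
      using Cons.prems(5)[of 0] Cons.prems(5)[of 1] by auto
    with body[of s a x xs y] Cons.prems obtain s1 where
      1: "runs body s s1 (49 + 9 * S a + poly q (2 + S a))" "s1 K = encode a" "s1 (K + 1) = encode xs"
         "s1 (K + 2) = encode (g a x y)" "\<And>j. j \<ge> K + 3 \<Longrightarrow> s1 j = s j" by blast
    have "\<And>n. esize (fold (g a) (take n xs) (g a x y)) \<le> h a"
      using Cons.prems(5)[of "Suc _"] by simp
    with Cons.IH[of s1 "g a x y"] 1 Cons.prems(4) obtain s2 where
      2: "runs loop s1 s2 (Suc (length xs) * T a)" "s2 (K + 2) = encode (fold (g a) xs (g a x y))"
         "\<And>j. j \<ge> K + 3 \<Longrightarrow> s2 j = s1 j" by auto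
    have "runs loop s s2 (1 + cost (Var (K + 1)) s + (49 + 9 * S a + poly q (2 + S a)) + Suc (length xs) * T a)"
      unfolding loop_def using Cons.prems
      by (intro runs_WhileTrue[OF _ 1(1) 2(1)[unfolded loop_def]]) simp
    then have "runs loop s s2 (Suc (length (x # xs)) * T a)"
      by (rule runs_mono) (use Cons.prems in \<open>simp add: T_def S_def\<close>)
    with 1 2 show ?case by auto
  qed
  define B where "B = (\<lambda>a. 100 + 10 * S a + bl a + bi a + Suc (esize (l a)) * T a)"
  show ?thesis
  proof (rule ptimeI)
    have S: "psize S" unfolding S_def by (intro psize_intros psize_ptime[OF l] h)
    then have "psize T" unfolding T_def by (intro psize_intros psize_poly)
    with S show "psize B" unfolding B_def by (intro psize_intros bl bi psize_ptime[OF l])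
    show "realizes p (K + 3) B (\<lambda>a. fold (g a) (l a) (i a))"
      unfolding realizes_def
    proof (intro allI impI)
      fix a :: 'a and s :: state assume s: "s 0 = encode a"
      have "(s(K := encode a)) 0 = encode a" by (simp add: s K_def)
      from realizesE[of cl kl bl l "s(K := encode a)" a, OF cl this] obtain s1 where
        1: "runs cl (s(K := encode a)) s1 (bl a)" "s1 0 = encode (l a)"
           "\<And>j. kl \<le> j \<Longrightarrow> s1 j = (s(K := encode a)) j" by metis
      define s2 where "s2 = s1(K + 1 := encode (l a), 0 := encode a)"
      have "s2 0 = encode a" by (simp add: s2_def)
      from realizesE[of ci ki bi i s2 a, OF ci this] obtain s3 where
        3: "runs ci s2 s3 (bi a)" "s3 0 = encode (i a)" "\<And>j. ki \<le> j \<Longrightarrow> s3 j = s2 j" by metis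
      define s4 where "s4 = s3(K + 2 := encode (i a))"
      have ia: "esize (i a) \<le> h a" using bound[of a 0] by simp
      have fa: "esize (fold (g a) (l a) (i a)) \<le> h a" using bound[of a "length (l a)"] by simp
      have "s4 K = encode a" "s4 (K + 1) = encode (l a)" "s4 (K + 2) = encode (i a)"
        by (auto simp: s4_def 3 s2_def 1 K_def)
      from loop[OF this] bound obtain s5 where
        5: "runs loop s4 s5 (Suc (length (l a)) * T a)"
           "s5 (K + 2) = encode (fold (g a) (l a) (i a))" "\<And>j. j \<ge> K + 3 \<Longrightarrow> s5 j = s4 j" by auto
      define s6 where "s6 = s5(0 := encode (fold (g a) (l a) (i a)))"
      have "runs p s s6 (1 + (5 + S a) + (1 + bl a + (1 + (5 + S a) + (1 + (5 + S a) + (1 + bi a +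
               (1 + (5 + S a) + (1 + Suc (length (l a)) * T a + (5 + S a))))))))"
        unfolding p_def
      proof (intro runs_Seq)
        show "runs (Assign K (Var 0)) s (s(K := encode a)) (5 + S a)"
          by (rule runs_Assign) (auto simp: s S_def)
        show "runs cl (s(K := encode a)) s1 (bl a)" by fact
        show "runs (Assign (K + 1) (Var 0)) s1 (s1(K + 1 := encode (l a))) (5 + S a)"
          by (rule runs_Assign) (auto simp: 1 S_def)
        show "runs (Assign 0 (Var K)) (s1(K + 1 := encode (l a))) s2 (5 + S a)"
          by (rule runs_Assign) (auto simp: 1 s2_def S_def K_def)
        show "runs ci s2 s3 (bi a)" by fact
        show "runs (Assign (K + 2) (Var 0)) s3 s4 (5 + S a)"
          using ia by (intro runs_Assign) (auto simp: 3 s4_def S_def)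
        show "runs loop s4 s5 (Suc (length (l a)) * T a)" by fact
        show "runs (Assign 0 (Var (K + 2))) s5 s6 (5 + S a)"
          using fa 5 by (intro runs_Assign) (auto simp: s6_def S_def)
      qed
      then have "runs p s s6 (B a)"
      proof (rule runs_mono)
        have "Suc (length (l a)) * T a \<le> Suc (esize (l a)) * T a"
          by (intro mult_right_mono) (auto simp: length_le_esize)
        then show "1 + (5 + S a) + (1 + bl a + (1 + (5 + S a) + (1 + (5 + S a) + (1 + bi a +
               (1 + (5 + S a) + (1 + Suc (length (l a)) * T a + (5 + S a))))))) \<le> B a"
          unfolding B_def by linarith
      qed
      moreover have "s6 0 = encode (fold (g a) (l a) (i a))" by (simp add: s6_def)
      moreover have "\<forall>j\<ge>K + 3. s6 j = s j"
        by (auto simp: s6_def 5 s4_def 3 s2_def 1 K_def)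
      ultimately show "\<exists>s'. runs p s s' (B a) \<and> s' 0 = encode (fold (g a) (l a) (i a)) \<and>
          (\<forall>j\<ge>K + 3. s' j = s j)"
        by blast
    qed
  qed
qed

text \<open>If the growth per step is bounded in terms of the parameter and the list entry,
  independently of the accumulator, then sizes only add up along the list.\<close>

lemma ptime_fold:
  fixes g :: "'a::encodable \<Rightarrow> 'c::encodable \<Rightarrow> 'b::encodable \<Rightarrow> 'b"
  assumes g: "ptime (\<lambda>t. g (fst t) (fst (snd t)) (snd (snd t)))"
    and l: "ptime l" and i: "ptime i"
    and h: "psize h"
    and step: "\<And>a x y. x \<in> set (l a) \<Longrightarrow> esize (g a x y) \<le> esize y + h (a, x)"
  shows "ptime (\<lambda>a. fold (g a) (l a) (i a))"
proof -
  obtain q where q: "\<And>t. h t \<le> poly q (esize t)" using h unfolding psize_def by blast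
  define h' where "h' = (\<lambda>a. poly q (1 + esize a + esize (l a)))"
  show ?thesis
  proof (rule ptime_fold_bounded[OF g l i])
    show "psize (\<lambda>a. esize (i a) + esize (l a) * h' a)"
      unfolding h'_def by (intro psize_intros psize_poly psize_ptime i l)
    fix a n
    have step': "esize (g a x y) \<le> esize y + h' a" if "x \<in> set (l a)" for x y
    proof -
      have "h (a, x) \<le> h' a"
        unfolding h'_def using esize_mem[OF that] by (intro order_trans[OF q] poly_nat_mono) simp
      with step[OF that, of y] show ?thesis by linarith
    qed
    have "esize (fold (g a) xs y) \<le> esize y + length xs * h' a" if "set xs \<subseteq> set (l a)" for xs y
      using that
    proof (induction xs arbitrary: y)
      case (Cons x xs)
      then have "esize (fold (g a) (x # xs) y) \<le> esize (g a x y) + length xs * h' a" by simp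
      also have "\<dots> \<le> esize y + length (x # xs) * h' a" using Cons step'[of x y] by simp
      finally show ?case .
    qed simp
    from this[OF set_take_subset]
    have "esize (fold (g a) (take n (l a)) (i a)) \<le> esize (i a) + length (take n (l a)) * h' a" .
    also have "\<dots> \<le> esize (i a) + esize (l a) * h' a"
      using length_le_esize[of "l a"] by (intro add_left_mono mult_right_mono) auto
    finally show "esize (fold (g a) (take n (l a)) (i a)) \<le> esize (i a) + esize (l a) * h' a" .
  qed
qed

theorem solvable_in_polynomial_timeI:
  fixes f :: "'a::encodable \<Rightarrow> 'b::encodable"
  assumes "ptime f" and "\<And>t R. (t, R) \<in> P \<Longrightarrow> \<exists>a. t = encode a \<and> encode (f a) \<in> R"
  shows "solvable_in_polynomial_time P"
proof -
  obtain c k b where b: "psize b" and c: "realizes c k b f"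
    using assms(1) unfolding ptime_def by blast
  obtain q where q: "\<And>t. b t \<le> poly q (esize t)" using b unfolding psize_def by blast
  show ?thesis
    unfolding solvable_in_polynomial_time_def
  proof (intro exI[of _ c] exI[of _ q] ballI, clarify)
    fix t R assume "(t, R) \<in> P"
    then obtain a where a: "t = encode a" "encode (f a) \<in> R" using assms(2) by blast
    then have "((\<lambda>_. Leaf)(0 := t)) 0 = encode a" by simp
    from realizesE[of c k b f "(\<lambda>_. Leaf)(0 := t)" a, OF c this] obtain s' where
      "runs c ((\<lambda>_. Leaf)(0 := t)) s' (b a)" "s' 0 = encode (f a)" by metis
    with a q[of a] show "\<exists>n s. exec c ((\<lambda>_. Leaf)(0 := t)) n s \<and> n \<le> poly q (size t) \<and> s 0 \<in> R"
      unfolding runs_def by (metis order_trans)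
  qed
qed

subsection \<open>Lists, unary numbers and truth values\<close>

lemma ptime_not [ptime_intros]: "ptime f \<Longrightarrow> ptime (\<lambda>a. \<not> f a)"
  by (rule ptime_recode[OF ptime_if[of f "\<lambda>_. False" "\<lambda>_. True"]]) (auto intro: ptime_const)

lemma ptime_conj [ptime_intros]: "ptime f \<Longrightarrow> ptime g \<Longrightarrow> ptime (\<lambda>a. f a \<and> g a)"
  by (rule ptime_recode[OF ptime_if[of f g "\<lambda>_. False"]]) (auto intro: ptime_const)

lemma ptime_disj [ptime_intros]: "ptime f \<Longrightarrow> ptime g \<Longrightarrow> ptime (\<lambda>a. f a \<or> g a)"
  using ptime_not[OF ptime_conj[OF ptime_not ptime_not]] by simp

lemma ptime_bool_eq [ptime_intros]:
  "ptime f \<Longrightarrow> ptime g \<Longrightarrow> ptime (\<lambda>a. f a = g a)" for f g :: "_ \<Rightarrow> bool"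
proof -
  assume "ptime f" "ptime g"
  then have "ptime (\<lambda>a. f a \<and> g a \<or> \<not> f a \<and> \<not> g a)" by (intro ptime_intros)
  also have "(\<lambda>a. f a \<and> g a \<or> \<not> f a \<and> \<not> g a) = (\<lambda>a. f a = g a)" by auto
  finally show ?thesis .
qed

lemma ptime_rev [ptime_intros]:
  assumes "ptime f" shows "ptime (\<lambda>a. rev (f a))"
proof -
  have "ptime (\<lambda>a. fold (\<lambda>x ys. x # ys) (f a) [])"
    by (rule ptime_fold[where h = "\<lambda>t. Suc (esize (snd t))"])
      (intro ptime_intros assms psize_intros psize_ptime | simp)+
  then show ?thesis by (simp add: rev_conv_fold)
qed

lemma ptime_append [ptime_intros]:
  assumes "ptime f" "ptime g" shows "ptime (\<lambda>a. f a @ g a)"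
proof -
  have "ptime (\<lambda>a. fold (\<lambda>x ys. x # ys) (rev (f a)) (g a))"
    by (rule ptime_fold[where h = "\<lambda>t. Suc (esize (snd t))"])
      (intro ptime_intros assms psize_intros psize_ptime | simp)+
  moreover have "fold (\<lambda>x ys. x # ys) (rev xs) ys = xs @ ys" for xs ys :: "'b list"
    by (induction xs) simp_all
  ultimately show ?thesis by simp
qed

lemma ptime_map [ptime_intros]:
  assumes f: "ptime (\<lambda>t. f (fst t) (snd t))" and l: "ptime l"
  shows "ptime (\<lambda>a. map (f a) (l a))"
proof -
  have g: "ptime (\<lambda>t. f (fst t) (fst (snd t)))"
    using ptime_comp[OF ptime_Pair[OF ptime_fst[OF ptime_id] ptime_fst[OF ptime_snd[OF ptime_id]]] f]
    by simp
  have "ptime (\<lambda>a. rev (fold (\<lambda>x ys. f a x # ys) (l a) []))"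
    by (intro ptime_rev ptime_fold[where h = "\<lambda>t. Suc (esize (f (fst t) (snd t)))"])
      (intro ptime_intros g assms psize_intros psize_ptime | simp)+
  moreover have "fold (\<lambda>x ys. f a x # ys) xs zs = rev (map (f a) xs) @ zs" for a xs zs
    by (induction xs arbitrary: zs) simp_all
  ultimately show ?thesis by simp
qed

lemma ptime_filter [ptime_intros]:
  assumes p: "ptime (\<lambda>t. p (fst t) (snd t))" and l: "ptime l"
  shows "ptime (\<lambda>a. filter (p a) (l a))"
proof -
  have g: "ptime (\<lambda>t. p (fst t) (fst (snd t)))"
    using ptime_comp[OF ptime_Pair[OF ptime_fst[OF ptime_id] ptime_fst[OF ptime_snd[OF ptime_id]]] p]
    by simp
  have "ptime (\<lambda>a. rev (fold (\<lambda>x ys. if p a x then x # ys else ys) (l a) []))"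
    by (intro ptime_rev ptime_fold[where h = "\<lambda>t. Suc (esize (snd t))"])
      (intro ptime_intros g assms psize_intros psize_ptime | simp)+
  moreover have "fold (\<lambda>x ys. if p a x then x # ys else ys) xs zs = rev (filter (p a) xs) @ zs" for a xs zs
    by (induction xs arbitrary: zs) simp_all
  ultimately show ?thesis by simp
qed

lemma ptime_Bex [ptime_intros]:
  assumes p: "ptime (\<lambda>t. p (fst t) (snd t))" and l: "ptime l"
  shows "ptime (\<lambda>a. \<exists>x\<in>set (l a). p a x)"
  using ptime_not_Nil[OF ptime_filter[OF assms]] by (simp add: filter_empty_conv)

lemma ptime_Ball [ptime_intros]:
  assumes p: "ptime (\<lambda>t. p (fst t) (snd t))" and l: "ptime l"
  shows "ptime (\<lambda>a. \<forall>x\<in>set (l a). p a x)"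
  using ptime_not[OF ptime_Bex[OF ptime_not[OF p] l]] by simp

lemma ptime_concat [ptime_intros]:
  assumes "ptime f" shows "ptime (\<lambda>a. concat (f a))"
proof -
  have "ptime (\<lambda>a. fold (\<lambda>x ys. ys @ x) (f a) [])"
    by (rule ptime_fold[where h = "\<lambda>t. esize (snd t)"])
      (intro ptime_intros assms psize_intros psize_ptime | simp)+
  moreover have "fold (\<lambda>x ys. ys @ x) xs zs = zs @ concat xs" for xs :: "'b list list" and zs
    by (induction xs arbitrary: zs) simp_all
  ultimately show ?thesis by simp
qed

text \<open>Unary numbers and lists of units have the same encoding. So a number can drive a fold as
  a loop counter, and arithmetic reduces to list operations.\<close>

lemma ptime_replicate_unit: "ptime f \<Longrightarrow> ptime (\<lambda>a. replicate (f a) ())"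
proof (erule ptime_recode)
  show "encode (replicate n ()) = encode n" for n by (induction n) simp_all
qed

lemma ptime_replicate [ptime_intros]:
  assumes "ptime f" "ptime g" shows "ptime (\<lambda>a. replicate (f a) (g a))"
proof -
  have "ptime (\<lambda>a. map (\<lambda>_. g a) (replicate (f a) ()))"
    by (intro ptime_intros ptime_replicate_unit assms ptime_comp[OF _ assms(2)])
  then show ?thesis by simp
qed

lemma ptime_length [ptime_intros]:
  assumes "ptime f" shows "ptime (\<lambda>a. length (f a))"
proof (rule ptime_recode)
  have length: "encode (length xs) = encode (map (\<lambda>_. ()) xs)" for xs :: "'b list"
    by (induction xs) simp_all
  show "ptime (\<lambda>a. map (\<lambda>_. ()) (f a))" by (intro ptime_intros assms)
  show "encode (length (f a)) = encode (map (\<lambda>_. ()) (f a))" for a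
    by (rule length)
qed

lemma ptime_add [ptime_intros]:
  assumes "ptime f" "ptime g" shows "ptime (\<lambda>a. f a + g a :: nat)"
proof -
  have "ptime (\<lambda>a. length (replicate (f a) () @ replicate (g a) ()))"
    by (intro ptime_intros assms)
  then show ?thesis by simp
qed

lemma ptime_mult [ptime_intros]:
  assumes "ptime f" "ptime g" shows "ptime (\<lambda>a. f a * g a :: nat)"
proof -
  have "ptime (\<lambda>a. length (concat (replicate (f a) (replicate (g a) ()))))"
    by (intro ptime_intros assms)
  then show ?thesis by (simp add: length_concat sum_list_replicate)
qed

lemma ptime_drop [ptime_intros]:
  assumes "ptime n" "ptime f" shows "ptime (\<lambda>a. drop (n a) (f a))"
proof -
  have "ptime (\<lambda>a. fold (\<lambda>_ xs. tl xs) (replicate (n a) ()) (f a))"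
    by (rule ptime_fold[where h = "\<lambda>_. 0"])
      (intro ptime_intros assms psize_intros esize_tl | simp add: esize_tl)+
  moreover have "fold (\<lambda>_ xs. tl xs) (replicate k ()) xs = drop k xs" for k and xs :: "'b list"
    by (induction k arbitrary: xs) (simp_all add: drop_Suc)
  ultimately show ?thesis by simp
qed

lemma ptime_diff [ptime_intros]:
  assumes "ptime f" "ptime g" shows "ptime (\<lambda>a. f a - g a :: nat)"
proof -
  have "ptime (\<lambda>a. length (drop (g a) (replicate (f a) ())))"
    by (intro ptime_intros assms)
  then show ?thesis by simp
qed

lemma ptime_take [ptime_intros]:
  assumes "ptime n" "ptime f" shows "ptime (\<lambda>a. take (n a) (f a))"
proof -
  have "ptime (\<lambda>a. rev (drop (length (f a) - n a) (rev (f a))))"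
    by (intro ptime_intros assms)
  moreover have "rev (drop (length xs - k) (rev xs)) = take k xs" for k and xs :: "'b list"
    by (metis rev_rev_ident length_rev take_rev rev_take)
  ultimately show ?thesis by simp
qed

lemma ptime_nat_less [ptime_intros]:
  assumes "ptime f" "ptime g" shows "ptime (\<lambda>a. f a < (g a :: nat))"
proof -
  have "ptime (\<lambda>a. replicate (g a - f a) () \<noteq> [])"
    by (intro ptime_intros assms)
  then show ?thesis by (simp add: not_le)
qed

lemma ptime_nat_le [ptime_intros]: "ptime f \<Longrightarrow> ptime g \<Longrightarrow> ptime (\<lambda>a. f a \<le> (g a :: nat))"
  using ptime_not[OF ptime_nat_less[of g f]] by (simp add: not_less)

lemma ptime_nat_eq [ptime_intros]: "ptime f \<Longrightarrow> ptime g \<Longrightarrow> ptime (\<lambda>a. f a = (g a :: nat))"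
  using ptime_conj[OF ptime_nat_le[of f g] ptime_nat_le[of g f]] by (simp add: eq_iff)

lemma ptime_zip [ptime_intros]:
  assumes "ptime f" "ptime g" shows "ptime (\<lambda>a. zip (f a) (g a))"
proof -
  define h where "h = (\<lambda>(x::'b) s. case fst s of [] \<Rightarrow> s | (y::'c) # ys \<Rightarrow> (ys, (x, y) # snd s))"
  have "ptime (\<lambda>t. h (fst (snd t)) (snd (snd t)))"
    unfolding h_def by (intro ptime_intros)
  moreover have "esize (h x s) \<le> esize s + (2 + esize x)" for x s
    by (cases s; cases "fst s") (auto simp: h_def)
  ultimately have "ptime (\<lambda>a. rev (snd (fold h (f a) (g a, []))))"
    by (intro ptime_intros ptime_fold[where h = "\<lambda>t. 2 + esize (snd t)"])
      (intro ptime_intros assms psize_intros psize_ptime | simp)+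
  moreover have "snd (fold h xs (ys, zs)) = rev (zip xs ys) @ zs" for xs ys zs
  proof (induction xs arbitrary: ys zs)
    case (Cons x xs)
    show ?case
    proof (cases ys)
      case Nil
      have "fold h xs' ([], zs) = ([], zs)" for xs'
        by (induction xs') (simp_all add: h_def)
      from this[of "x # xs"] Nil show ?thesis by simp
    qed (simp add: h_def Cons.IH[unfolded h_def])
  qed simp
  ultimately show ?thesis by simp
qed

text \<open>Each new entry is the length of the accumulator, so the growth per step is not
  independent of it and \<open>ptime_fold\<close> does not apply. But the intermediate lists are
  known exactly: they are again of the form \<open>[0..<k]\<close>.\<close>

lemma ptime_upt [ptime_intros]:
  assumes "ptime n" shows "ptime (\<lambda>a. [0..<n a])"
proof -
  have *: "fold (\<lambda>_ xs. xs @ [length xs]) (replicate k ()) [] = [0..<k]" for k :: nat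
  proof -
    have "fold (\<lambda>_ xs. xs @ [length xs]) (replicate k ()) [0..<j] = [0..<j + k]" for j
    proof (induction k arbitrary: j)
      case (Suc k)
      from Suc[of "Suc j"] show ?case by simp
    qed simp
    from this[of 0] show ?thesis by simp
  qed
  have size: "esize [0..<k] \<le> k * k" for k
    by (induction k) simp_all
  have "ptime (\<lambda>a. fold (\<lambda>_ xs. xs @ [length xs]) (replicate (n a) ()) [])"
  proof (rule ptime_fold_bounded)
    show "psize (\<lambda>a. n a * n a)"
      by (intro psize_intros psize_ptime_nat assms)
    show "esize (fold (\<lambda>_ xs. xs @ [length xs]) (take k (replicate (n a) ())) []) \<le> n a * n a" for a k
      using order_trans[OF size[of "min k (n a)"], of "n a * n a"]
      unfolding take_replicate * by (simp add: mult_mono)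
  qed (intro ptime_intros assms)+
  then show ?thesis by (simp only: *)
qed

text \<open>Programs index with the total \<open>nth_default\<close>, as \<open>nth\<close> is
  unspecified beyond the end of a list.\<close>

lemma ptime_nth_default [ptime_intros]:
  assumes "ptime f" "ptime n" shows "ptime (\<lambda>a. nth_default d (f a) (n a))"
proof -
  have "ptime (\<lambda>a. case drop (n a) (f a) of [] \<Rightarrow> d | x # _ \<Rightarrow> x)"
    by (intro ptime_intros assms)
  moreover have "(case drop k xs of [] \<Rightarrow> d | x # _ \<Rightarrow> x) = nth_default d xs k" for k xs
    by (auto simp: nth_default_def Cons_nth_drop_Suc[symmetric])
  ultimately show ?thesis by simp
qed

lemma ptime_list_update [ptime_intros]:
  assumes "ptime f" "ptime n" "ptime g" shows "ptime (\<lambda>a. (f a)[n a := g a])"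
proof (rule ptime_recode)
  show "ptime (\<lambda>a. if n a < length (f a) then take (n a) (f a) @ g a # drop (Suc (n a)) (f a) else f a)"
    by (intro ptime_intros assms)
qed (simp add: upd_conv_take_nth_drop list_update_beyond)

lemma ptime_sum_list [ptime_intros]:
  assumes "ptime f" shows "ptime (\<lambda>a. sum_list (f a) :: nat)"
proof -
  have "ptime (\<lambda>a. fold (\<lambda>x y. y + x) (f a) (0::nat))"
    by (rule ptime_fold[where h = "\<lambda>t. snd t"])
      (intro ptime_intros assms psize_intros psize_ptime_nat | simp)+
  moreover have "fold (\<lambda>x y. y + x) xs y = y + sum_list xs" for xs and y :: nat
    by (induction xs arbitrary: y) simp_all
  ultimately show ?thesis by simp
qed

lemma ptime_bools_eq [ptime_intros]:
  assumes "ptime f" "ptime g" shows "ptime (\<lambda>a. f a = (g a :: bool list))"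
proof -
  have "ptime (\<lambda>a. length (f a) = length (g a) \<and> (\<forall>p\<in>set (zip (f a) (g a)). fst p = snd p))"
    by (intro ptime_intros assms)
  then show ?thesis by (simp add: list_eq_iff_zip_eq case_prod_beta)
qed

section \<open>The auction algorithm\<close>

definition argmin :: "nat list \<Rightarrow> nat" where
  "argmin vs = (case filter (\<lambda>p. \<forall>v\<in>set vs. snd p \<le> v) (zip [0..<length vs] vs) of
     [] \<Rightarrow> 0 | p # _ \<Rightarrow> fst p)"

lemma argmin:
  assumes "vs \<noteq> []"
  shows "argmin vs < length vs" and "\<And>v. v \<in> set vs \<Longrightarrow> vs ! argmin vs \<le> v"
proof -
  let ?f = "filter (\<lambda>p. \<forall>v\<in>set vs. snd p \<le> v) (zip [0..<length vs] vs)"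
  have "Min (set vs) \<in> set vs" using assms by simp
  then obtain k where k: "k < length vs" "vs ! k = Min (set vs)" by (auto simp: in_set_conv_nth)
  then have "(k, vs ! k) \<in> set ?f" by (auto simp: in_set_zip intro!: exI[of _ k])
  then obtain p ps where f: "?f = p # ps" by (cases ?f) auto
  then have "p \<in> set ?f" by simp
  then have "fst p < length vs" "vs ! fst p = snd p" "\<forall>v\<in>set vs. snd p \<le> v"
    by (auto simp: in_set_zip)
  with f show "argmin vs < length vs" and "\<And>v. v \<in> set vs \<Longrightarrow> vs ! argmin vs \<le> v"
    by (auto simp: argmin_def)
qed

lemma ptime_argmin [ptime_intros]: "ptime f \<Longrightarrow> ptime (\<lambda>a. argmin (f a))"
  unfolding argmin_def by (erule ptime_comp) (intro ptime_intros)

definition unassigned :: "nat list list \<Rightarrow> (nat \<times> nat) list \<Rightarrow> nat list" where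
  "unassigned M A = filter (\<lambda>i. \<forall>p\<in>set A. fst p \<noteq> i) [0..<length M]"

text \<open>A state consists of the pairs (person, object) assigned so far and the prices of the objects.\<close>

definition bid :: "nat list list \<Rightarrow> (nat \<times> nat) list \<times> nat list \<Rightarrow> (nat \<times> nat) list \<times> nat list" where
  "bid M s = (case unassigned M (fst s) of [] \<Rightarrow> s | i # _ \<Rightarrow>
     let j = argmin (map (\<lambda>p. fst p + snd p) (zip (nth_default [] M i) (snd s)))
     in ((i, j) # filter (\<lambda>p. snd p \<noteq> j) (fst s), (snd s)[j := Suc (nth_default 0 (snd s) j)]))"

definition total :: "nat list list \<Rightarrow> nat" where
  "total M = sum_list (map sum_list M)"

text \<open>Each bid raises the sum of the prices by one, and no price exceeds
  \<open>Suc (total M)\<close>; so after \<open>N * Suc (total M)\<close> bids no further one is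
  possible. Once everybody is assigned, \<open>bid\<close> changes nothing, so surplus rounds are
  harmless.\<close>

definition auction :: "nat \<Rightarrow> nat list list \<Rightarrow> (nat \<times> nat) list" where
  "auction N M = fst (fold (\<lambda>_. bid M) (replicate (Suc (N * Suc (total M))) ()) ([], replicate N 0))"

section \<open>Running time of the auction\<close>

lemma ptime_unassigned [ptime_intros]:
  "ptime f \<Longrightarrow> ptime g \<Longrightarrow> ptime (\<lambda>a. unassigned (f a) (g a))"
proof -
  assume "ptime f" "ptime g"
  moreover have "ptime (\<lambda>t. unassigned (fst t) (snd t))"
    unfolding unassigned_def by (intro ptime_intros)
  ultimately show ?thesis using ptime_comp[OF ptime_Pair[of f g]] by fastforce
qed

lemma ptime_total [ptime_intros]: "ptime f \<Longrightarrow> ptime (\<lambda>a. total (f a))"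
  unfolding total_def by (erule ptime_comp) (intro ptime_intros)

lemma ptime_bid: "ptime (\<lambda>t. bid (fst t) (snd t))"
  unfolding bid_def by (intro ptime_intros)

lemma esize_list_update_Suc: "esize (P[j := Suc (nth_default 0 P j)]) \<le> Suc (esize P)"
proof (cases "j < length P")
  case True
  then show ?thesis
    by (subst (2) id_take_nth_drop[OF True]) (simp add: upd_conv_take_nth_drop nth_default_def)
qed (simp add: list_update_beyond)

lemma argmin_le: "argmin vs \<le> length vs"
  using argmin(1)[of vs] by (cases "vs = []") (auto simp: argmin_def)

text \<open>\<open>ptime_fold\<close> asks for a growth bound on arbitrary states, not only on
  reachable ones. It holds because \<open>zip\<close> cuts the candidates to the length of a row of
  \<open>M\<close>, which bounds the object index, and one price grows by one.\<close>

lemma esize_bid: "esize (bid M s) \<le> esize s + (5 + 2 * esize M)"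
proof (cases "unassigned M (fst s)")
  case (Cons i us)
  then have "i \<in> set (unassigned M (fst s))" by simp
  then have "i < length M" by (simp add: unassigned_def)
  then have i: "i \<le> esize M" and r: "esize (nth_default [] M i) \<le> esize M"
    using length_le_esize[of M] esize_mem[of "M ! i" M] by (auto simp: nth_default_def less_imp_le)
  obtain A P where s: "s = (A, P)" by (cases s)
  define j where "j = argmin (map (\<lambda>p. fst p + snd p) (zip (nth_default [] M i) P))"
  have "j \<le> length (nth_default [] M i)"
    unfolding j_def by (rule order_trans[OF argmin_le]) simp
  then have "j \<le> esize M" using r length_le_esize[of "nth_default [] M i"] by simp
  then show ?thesis
    using Cons i esize_filter[of "\<lambda>p. snd p \<noteq> j" A] esize_list_update_Suc[of P j]
    by (simp add: s bid_def j_def[symmetric] Let_def)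
qed (simp add: bid_def)

lemma ptime_auction [ptime_intros]:
  assumes "ptime f" "ptime g" shows "ptime (\<lambda>a. auction (f a) (g a))"
proof -
  define h where "h = (\<lambda>t :: nat \<times> nat list list. fold (\<lambda>_. bid (snd t))
     (replicate (Suc (fst t * Suc (total (snd t)))) ()) ([], replicate (fst t) 0))"
  have "ptime (\<lambda>t :: (nat \<times> nat list list) \<times> unit \<times> _. bid (snd (fst t)) (snd (snd t)))"
  proof -
    have "ptime (\<lambda>t :: (nat \<times> nat list list) \<times> unit \<times> (nat \<times> nat) list \<times> nat list. (snd (fst t), snd (snd t)))"
      by (intro ptime_intros)
    from ptime_comp[OF this ptime_bid] show ?thesis by simp
  qed
  then have "ptime h"
    unfolding h_def
    by (intro ptime_fold[where h = "\<lambda>t :: (nat \<times> nat list list) \<times> unit. 5 + 2 * esize (snd (fst t))"])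
      (intro ptime_intros psize_intros psize_ptime | simp add: esize_bid)+
  from ptime_comp[OF ptime_Pair[OF assms] ptime_fst[OF this]] show ?thesis
    by (simp add: auction_def h_def)
qed

section \<open>Correctness of the auction\<close>

locale assignment_problem =
  fixes N :: nat and M :: "nat list list"
  assumes rows: "\<And>r. r \<in> set M \<Longrightarrow> length r = N"
    and persons: "length M \<le> N"
begin

lemma entry_le_total: "i < length M \<Longrightarrow> j < N \<Longrightarrow> M ! i ! j \<le> total M"
proof -
  assume i: "i < length M" and j: "j < N"
  then have "M ! i ! j \<le> sum_list (M ! i)"
    using rows[of "M ! i"] by (intro member_le_sum_list) auto
  also have "\<dots> \<le> total M"
    unfolding total_def using i by (intro member_le_sum_list) auto
  finally show ?thesis .
qed

text \<open>The last but one condition is complementary slackness up to the bidding increment 1.\<close>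

definition inv :: "(nat \<times> nat) list \<Rightarrow> nat list \<Rightarrow> bool" where
  "inv A P \<longleftrightarrow> length P = N \<and> inj_on fst (set A) \<and> inj_on snd (set A) \<and>
     set A \<subseteq> {..<length M} \<times> {..<N} \<and>
     (\<forall>j<N. j \<notin> snd ` set A \<longrightarrow> P ! j = 0) \<and>
     (\<forall>(i, j)\<in>set A. \<forall>k<N. M ! i ! j + P ! j \<le> M ! i ! k + P ! k + 1) \<and>
     (\<forall>j<N. P ! j \<le> Suc (total M))"

lemma inv_bid:
  assumes inv: "inv A P" and un: "unassigned M A \<noteq> []"
  shows "\<exists>A' P'. bid M (A, P) = (A', P') \<and> inv A' P' \<and> sum_list P' = Suc (sum_list P)"
proof -
  obtain i us where us: "unassigned M A = i # us" using un by (cases "unassigned M A") auto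
  then have "i \<in> set (unassigned M A)" by simp
  then have i: "i < length M" "i \<notin> fst ` set A" by (auto simp: unassigned_def)
  then have iA: "(i, b) \<notin> set A" for b by force
  have len: "length P = N" "length (M ! i) = N" using inv rows i by (auto simp: inv_def)
  have N: "N > 0" using i persons by simp
  define vs where "vs = map (\<lambda>p. fst p + snd p) (zip (M ! i) P)"
  have vs: "length vs = N" "\<And>k. k < N \<Longrightarrow> vs ! k = M ! i ! k + P ! k"
    using len by (auto simp: vs_def)
  define j where "j = argmin vs"
  have "vs \<noteq> []" using vs N by auto
  from argmin[OF this] have j: "j < N" "\<And>k. k < N \<Longrightarrow> M ! i ! j + P ! j \<le> M ! i ! k + P ! k"
    using vs by (auto simp: j_def) (metis nth_mem)
  define A' where "A' = (i, j) # filter (\<lambda>p. snd p \<noteq> j) A"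
  define P' where "P' = P[j := Suc (P ! j)]"
  have bid: "bid M (A, P) = (A', P')"
    using i j len by (simp add: bid_def us A'_def P'_def nth_default_def vs_def[symmetric] j_def[symmetric] Let_def)
  have P': "P' ! k = (if k = j then Suc (P ! j) else P ! k)" if "k < N" for k
    using that len by (simp add: P'_def)
  \<comment> \<open>As \<open>i\<close> is unassigned, there are fewer pairs than objects and some
    \<open>k\<close> is free. Its price 0 will cap the price of the preferred \<open>j\<close>
    before the bid by an entry of the matrix.\<close>
  obtain k where k: "k < N" "k \<notin> snd ` set A"
  proof -
    have "fst ` set A \<subseteq> {..<length M} - {i}" using inv i by (auto simp: inv_def)
    then have "card (fst ` set A) \<le> card ({..<length M} - {i})" by (intro card_mono) auto
    then have "card (set A) < N" using inv i persons by (simp add: inv_def card_image)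
    then have "card (snd ` set A) < card {..<N}"
      using card_image_le[of "set A" snd] by simp
    then have "\<not> {..<N} \<subseteq> snd ` set A" by (metis card_mono List.finite_set finite_imageI not_less)
    then show ?thesis using that by auto
  qed
  have "inv A' P'"
    unfolding inv_def
  proof (intro conjI)
    show "length P' = N" using len by (simp add: P'_def)
    show "inj_on fst (set A')"
      using inv iA by (auto simp: inv_def A'_def inj_on_def)
    show "inj_on snd (set A')"
      using inv i by (auto simp: inv_def A'_def inj_on_def)
    show "set A' \<subseteq> {..<length M} \<times> {..<N}"
      using inv i j by (auto simp: inv_def A'_def)
    \<comment> \<open>An object once assigned is only handed on and never becomes free again. This
      matters since there may be more objects than persons.\<close>
    show "\<forall>j<N. j \<notin> snd ` set A' \<longrightarrow> P' ! j = 0"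
    proof (intro allI impI)
      fix k assume k: "k < N" "k \<notin> snd ` set A'"
      then have "k \<noteq> j" by (auto simp: A'_def)
      moreover have "k \<notin> snd ` set A"
        using k \<open>k \<noteq> j\<close> by (force simp: A'_def)
      ultimately show "P' ! k = 0" using inv k P' by (auto simp: inv_def)
    qed
    \<comment> \<open>For the bidder, \<open>j\<close> was cheapest before the bid, and the slack of
      1 absorbs its new price. The other persons keep objects whose prices have not changed, while
      alternatives can only have become more expensive.\<close>
    show "\<forall>(i', j')\<in>set A'. \<forall>k<N. M ! i' ! j' + P' ! j' \<le> M ! i' ! k + P' ! k + 1"
    proof (clarify)
      fix i' j' k assume ij: "(i', j') \<in> set A'" and k: "k < N"
      show "M ! i' ! j' + P' ! j' \<le> M ! i' ! k + P' ! k + 1"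
      proof (cases "(i', j') = (i, j)")
        case True
        then show ?thesis using j(2)[OF k] P' k j(1) by auto
      next
        case False
        then have *: "(i', j') \<in> set A" "j' \<noteq> j" using ij by (auto simp: A'_def)
        then have "j' < N" using inv by (auto simp: inv_def)
        have "M ! i' ! j' + P ! j' \<le> M ! i' ! k + P ! k + 1"
          using inv * k unfolding inv_def by blast
        then show ?thesis using P' \<open>j' < N\<close> * k by auto
      qed
    qed
    show "\<forall>j<N. P' ! j \<le> Suc (total M)"
    proof -
      have "P ! k = 0" using inv k by (simp add: inv_def)
      then have "P ! j \<le> total M"
        using j(2)[OF k(1)] entry_le_total[OF i(1) k(1)] by simp
      then show ?thesis using inv P' by (auto simp: inv_def)
    qed
  qed
  moreover have "sum_list P' = Suc (sum_list P)"
    using j len by (simp add: P'_def sum_list_update add.commute)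
  ultimately show ?thesis using bid by blast
qed

lemma auction_complete: "\<exists>P. inv (auction N M) P \<and> unassigned M (auction N M) = []"
proof -
  define st where "st k = fold (\<lambda>_. bid M) (replicate k ()) ([], replicate N 0)" for k
  have st_Suc: "st (Suc k) = bid M (st k)" for k
    unfolding st_def by (simp only: replicate_Suc replicate_append_same[symmetric] fold_append) simp
  have "inv (fst (st k)) (snd (st k)) \<and>
      (unassigned M (fst (st k)) = [] \<or> sum_list (snd (st k)) = k)" for k
  proof (induction k)
    case 0
    show ?case by (simp add: st_def inv_def sum_list_replicate)
  next
    case (Suc k)
    obtain A P where AP: "st k = (A, P)" by (cases "st k")
    show ?case
    proof (cases "unassigned M A = []")
      case True
      then have "bid M (A, P) = (A, P)" by (simp add: bid_def)
      then show ?thesis using Suc True by (simp add: st_Suc AP)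
    next
      case False
      then show ?thesis using inv_bid[of A P] Suc by (auto simp: st_Suc AP)
    qed
  qed
  moreover have "sum_list (snd (st k)) < Suc (N * Suc (total M))" if "inv (fst (st k)) (snd (st k))" for k
  proof -
    have "sum_list (snd (st k)) = (\<Sum>j<N. snd (st k) ! j)"
      using that by (simp add: inv_def sum_list_sum_nth atLeast0LessThan)
    also have "\<dots> \<le> (\<Sum>j<N. Suc (total M))"
      using that by (intro sum_mono) (auto simp: inv_def)
    finally show ?thesis by simp
  qed
  ultimately have "inv (fst (st k)) (snd (st k)) \<and> unassigned M (fst (st k)) = []"
    if "k = Suc (N * Suc (total M))" for k
    using that by (metis less_irrefl)
  then show ?thesis unfolding auction_def st_def by blast
qed

text \<open>Weak duality by hand: sum the slackness condition over all persons, which costs 1 for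
  each. The prices cancel in the right direction, because the objects of \<open>\<sigma>\<close>
  carry the sum of all prices, free objects having price 0.\<close>

lemma auction_optimal:
  obtains \<sigma> where "set (auction N M) = (\<lambda>i. (i, \<sigma> i)) ` {..<length M}"
    and "inj_on \<sigma> {..<length M}" and "\<sigma> ` {..<length M} \<subseteq> {..<N}"
    and "\<And>\<tau>. inj_on \<tau> {..<length M} \<Longrightarrow> \<tau> ` {..<length M} \<subseteq> {..<N} \<Longrightarrow>
      (\<Sum>i<length M. M ! i ! \<sigma> i) \<le> (\<Sum>i<length M. M ! i ! \<tau> i) + length M"
proof -
  let ?A = "auction N M" and ?I = "{..<length M}"
  obtain P where inv: "inv ?A P" and un: "unassigned M ?A = []" using auction_complete by blast
  have inj_A: "inj_on fst (set ?A)" "inj_on snd (set ?A)" using inv by (simp_all add: inv_def)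
  have fst_A: "fst ` set ?A = ?I"
  proof
    show "fst ` set ?A \<subseteq> ?I" using inv by (auto simp: inv_def)
    show "?I \<subseteq> fst ` set ?A" using un by (force simp: unassigned_def filter_empty_conv)
  qed
  have "\<forall>i\<in>?I. \<exists>j. (i, j) \<in> set ?A"
    unfolding fst_A[symmetric] by auto
  then obtain \<sigma> where \<sigma>: "\<And>i. i \<in> ?I \<Longrightarrow> (i, \<sigma> i) \<in> set ?A" by metis
  have A: "set ?A = (\<lambda>i. (i, \<sigma> i)) ` ?I"
  proof
    show "set ?A \<subseteq> (\<lambda>i. (i, \<sigma> i)) ` ?I"
    proof
      fix p assume p: "p \<in> set ?A"
      then have i: "fst p \<in> ?I" using fst_A by blast
      from inj_onD[OF inj_A(1) _ p \<sigma>[OF i]] have "p = (fst p, \<sigma> (fst p))" by simp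
      with i show "p \<in> (\<lambda>i. (i, \<sigma> i)) ` ?I" by blast
    qed
  qed (use \<sigma> in auto)
  have inj: "inj_on \<sigma> ?I"
  proof (rule inj_onI)
    fix i k assume ik: "i \<in> ?I" "k \<in> ?I" "\<sigma> i = \<sigma> k"
    from inj_onD[OF inj_A(2) _ \<sigma>[OF ik(1)] \<sigma>[OF ik(2)]] ik show "i = k" by simp
  qed
  have ran: "\<sigma> ` ?I \<subseteq> {..<N}" using \<sigma> inv by (auto simp: inv_def)
  show thesis
  proof (rule that[OF A inj ran])
    fix \<tau> assume \<tau>: "inj_on \<tau> ?I" "\<tau> ` ?I \<subseteq> {..<N}"
    have "(\<Sum>i\<in>?I. P ! \<tau> i) = (\<Sum>j\<in>\<tau> ` ?I. P ! j)" using \<tau> by (simp add: sum.reindex)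
    also have "\<dots> \<le> (\<Sum>j<N. P ! j)" using \<tau> by (intro sum_mono2) auto
    also have "\<dots> = (\<Sum>j\<in>\<sigma> ` ?I. P ! j)"
      using ran inv A by (intro sum.mono_neutral_right) (auto simp: inv_def image_image)
    also have "\<dots> = (\<Sum>i\<in>?I. P ! \<sigma> i)" using inj by (simp add: sum.reindex)
    finally have P: "(\<Sum>i\<in>?I. P ! \<tau> i) \<le> (\<Sum>i\<in>?I. P ! \<sigma> i)" .
    have "(\<Sum>i\<in>?I. M ! i ! \<sigma> i + P ! \<sigma> i) \<le> (\<Sum>i\<in>?I. M ! i ! \<tau> i + P ! \<tau> i + 1)"
    proof (rule sum_mono)
      fix i assume i: "i \<in> ?I"
      then have "\<tau> i < N" using \<tau> by auto
      then show "M ! i ! \<sigma> i + P ! \<sigma> i \<le> M ! i ! \<tau> i + P ! \<tau> i + 1"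
        using \<sigma>[OF i] inv unfolding inv_def by blast
    qed
    then show "(\<Sum>i\<in>?I. M ! i ! \<sigma> i) \<le> (\<Sum>i\<in>?I. M ! i ! \<tau> i) + length M"
      using P unfolding sum.distrib by simp
  qed
qed

end

section \<open>Binary arithmetic\<close>

abbreviation bval :: "bool list \<Rightarrow> nat" where
  "bval \<equiv> horner_sum of_bool 2"

text \<open>Follows the recursion of \<open>enc_nat\<close>, so that a binary number of the input is
  literally an encoded list of bits. By injectivity, vertices can be compared through their
  codes.\<close>

fun bits :: "nat \<Rightarrow> bool list" where
  "bits 0 = []"
| "bits (Suc n) = odd (Suc n) # bits (Suc n div 2)"

lemma bval_bits: "bval (bits n) = n"
proof (induction n rule: bits.induct)
  case (2 n)
  show ?case unfolding bits.simps horner_sum_simps 2 by (simp add: of_bool_odd_eq_mod_2)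
qed simp

lemma inj_bits: "inj bits"
  by (metis bval_bits injI)

lemma encode_bits: "encode (bits n) = enc_nat n"
  by (induction n rule: bits.induct) (simp_all add: encode_bool_def)

text \<open>With the least significant bit first, the padding consists of leading zeros and
  preserves the values.\<close>

definition align :: "bool list \<Rightarrow> bool list \<Rightarrow> (bool \<times> bool) list" where
  "align xs ys = zip (xs @ replicate (length ys - length xs) False) (ys @ replicate (length xs - length ys) False)"

lemma bval_replicate_False: "bval (replicate n False) = 0"
  by (induction n) simp_all

lemma bval_align: "bval (map fst (align xs ys)) = bval xs" "bval (map snd (align xs ys)) = bval ys"
  by (simp_all add: align_def horner_sum_append bval_replicate_False)

lemma length_align: "length (align xs ys) = max (length xs) (length ys)"
  by (simp add: align_def)

text \<open>The state holds the carry and the digits so far, latest first.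
  \<open>(a = b) = c\<close> is the exclusive or of three bits, and the first component is their
  majority.\<close>

definition full_adder :: "bool \<times> bool \<Rightarrow> bool \<times> bool list \<Rightarrow> bool \<times> bool list" where
  "full_adder p s = (fst p \<and> snd p \<or> fst s \<and> (fst p \<or> snd p), ((fst p = snd p) = fst s) # snd s)"

definition badd :: "bool list \<Rightarrow> bool list \<Rightarrow> bool list" where
  "badd xs ys = (let s = fold full_adder (align xs ys) (False, []) in rev (fst s # snd s))"

text \<open>The loop invariant of the adder: carry and remaining digits count with the weight of the
  next position, and one step trades two digits and a carry for one digit and a carry of double
  weight.\<close>

lemma bval_full_adder:
  "bval (rev (snd (fold full_adder ps s)) @ [fst (fold full_adder ps s)]) =
     bval (rev (snd s)) + 2 ^ length (snd s) * (of_bool (fst s) + bval (map fst ps) + bval (map snd ps))"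
proof (induction ps arbitrary: s)
  case Nil
  show ?case by (simp add: horner_sum_append)
next
  case (Cons p ps)
  have "bval (rev (snd (full_adder p s))) + 2 ^ length (snd (full_adder p s)) *
      (of_bool (fst (full_adder p s)) + m + n) =
    bval (rev (snd s)) + 2 ^ length (snd s) * (of_bool (fst s) + (of_bool (fst p) + 2 * m) + (of_bool (snd p) + 2 * n))"
    for m n
    by (cases "fst p"; cases "snd p"; cases "fst s")
      (simp_all add: full_adder_def horner_sum_append algebra_simps)
  then show ?case unfolding fold_simps Cons.IH by simp
qed

lemma bval_badd: "bval (badd xs ys) = bval xs + bval ys"
  using bval_full_adder[of "align xs ys" "(False, [])"] by (simp add: badd_def Let_def bval_align)

lemma length_badd: "length (badd xs ys) = Suc (max (length xs) (length ys))"
proof -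
  have "length (snd (fold full_adder ps s)) = length (snd s) + length ps" for ps s
    by (induction ps arbitrary: s) (simp_all add: full_adder_def)
  then show ?thesis by (simp add: badd_def Let_def length_align)
qed

text \<open>The factor \<open>k\<close> is unary, so repeated addition is fast enough.\<close>

definition bmult :: "nat \<Rightarrow> bool list \<Rightarrow> bool list" where
  "bmult k ys = fold (\<lambda>_ xs. badd xs ys) (replicate k ()) []"

lemma bmult_Suc: "bmult (Suc k) ys = badd (bmult k ys) ys"
  unfolding bmult_def by (simp only: replicate_Suc replicate_append_same[symmetric] fold_append) simp

lemma bval_bmult: "bval (bmult k ys) = k * bval ys"
proof (induction k)
  case 0
  show ?case by (simp add: bmult_def)
qed (simp add: bmult_Suc bval_badd)

lemma length_bmult: "length (bmult k ys) \<le> length ys + k"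
proof (induction k)
  case 0
  show ?case by (simp add: bmult_def)
qed (simp add: bmult_Suc length_badd)

text \<open>The digits arrive in ascending order of significance, so every difference overrides the
  verdict reached before.\<close>

definition bless :: "bool list \<Rightarrow> bool list \<Rightarrow> bool" where
  "bless xs ys = fold (\<lambda>p b. if fst p = snd p then b else snd p) (align xs ys) False"

lemma bless: "bless xs ys \<longleftrightarrow> bval xs < bval ys"
proof -
  have "fold (\<lambda>p b. if fst p = snd p then b else snd p) ps b \<longleftrightarrow>
      bval (map fst ps) < bval (map snd ps) \<or> bval (map fst ps) = bval (map snd ps) \<and> b" for ps b
  proof (induction ps arbitrary: b)
    case (Cons p ps)
    obtain x y where "p = (x, y)" by (cases p)
    then show ?case by (cases x; cases y; cases b) (auto simp: Cons.IH)
  qed simp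
  then show ?thesis by (simp add: bless_def bval_align)
qed

lemma ptime_align [ptime_intros]:
  "ptime f \<Longrightarrow> ptime g \<Longrightarrow> ptime (\<lambda>a. align (f a) (g a))"
  unfolding align_def by (intro ptime_intros)

lemma ptime_badd [ptime_intros]:
  assumes "ptime f" "ptime g" shows "ptime (\<lambda>a. badd (f a) (g a))"
proof -
  have "ptime (\<lambda>a. fold full_adder (align (f a) (g a)) (False, []))"
  proof (rule ptime_fold[where h = "\<lambda>_. 3"])
    show "ptime (\<lambda>t :: 'a \<times> (bool \<times> bool) \<times> bool \<times> bool list. full_adder (fst (snd t)) (snd (snd t)))"
      unfolding full_adder_def by (intro ptime_intros)
    show "esize (full_adder p s) \<le> esize s + 3" for p s
      by (cases p; cases s; cases "fst (full_adder p s)"; cases "hd (snd (full_adder p s))")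
        (auto simp: full_adder_def)
  qed (intro ptime_intros psize_intros assms)+
  then show ?thesis unfolding badd_def by (intro ptime_intros) (auto intro: ptime_intros)
qed

lemma esize_bools: "esize (xs :: bool list) \<le> 2 * length xs"
proof (induction xs)
  case (Cons x xs)
  then show ?case by (cases x) simp_all
qed simp

lemma ptime_bmult [ptime_intros]:
  assumes "ptime f" "ptime g" shows "ptime (\<lambda>a. bmult (f a) (g a))"
  unfolding bmult_def
proof (rule ptime_fold_bounded)
  show "ptime (\<lambda>t. badd (snd (snd t)) (g (fst t)))"
    by (intro ptime_intros ptime_comp[OF _ assms(2)])
  show "psize (\<lambda>a. 2 * (esize (g a) + f a))"
    by (intro psize_intros psize_ptime psize_ptime_nat assms)
  fix a n
  have "esize (bmult k (g a)) \<le> 2 * (esize (g a) + f a)" if "k \<le> f a" for k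
  proof -
    have "esize (bmult k (g a)) \<le> 2 * length (bmult k (g a))" by (rule esize_bools)
    also have "\<dots> \<le> 2 * (length (g a) + k)" by (intro mult_left_mono length_bmult) simp
    also have "\<dots> \<le> 2 * (esize (g a) + f a)"
      using that by (intro mult_left_mono add_mono length_le_esize) simp_all
    finally show ?thesis .
  qed
  from this[of "min n (f a)"]
  show "esize (fold (\<lambda>_ xs. badd xs (g a)) (take n (replicate (f a) ())) []) \<le> 2 * (esize (g a) + f a)"
    unfolding take_replicate bmult_def by simp
qed (intro ptime_intros assms)+

lemma ptime_bless [ptime_intros]:
  assumes "ptime f" "ptime g" shows "ptime (\<lambda>a. bless (f a) (g a))"
  unfolding bless_def
proof (rule ptime_fold[where h = "\<lambda>_. 1"])
  show "esize (if fst p = snd p then b else snd p) \<le> esize b + 1" for p :: "bool \<times> bool" and b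
    by (cases p; cases "snd p") auto
qed (intro ptime_intros psize_intros assms)+

section \<open>Rational numbers and their comparison with unary numbers\<close>

type_synonym ratcode = "(bool \<times> bool list) \<times> bool list"

definition rval :: "ratcode \<Rightarrow> real" where
  "rval r = (if fst (fst r) then - 1 else 1) * real (bval (snd (fst r))) / real (bval (snd r))"

text \<open>The codes follow the layout of \<open>enc_rat\<close>. The condition on the sign bit
  excludes a negative zero, on which \<open>rat_below 0\<close> would err.\<close>

lemma enc_rat_code:
  "\<exists>r. enc_rat q = encode r \<and> rval r = of_rat q \<and> 0 < bval (snd r) \<and> (fst (fst r) \<longleftrightarrow> q < 0)"
proof -
  obtain a b where ab: "quotient_of q = (a, b)" by (cases "quotient_of q")
  have b: "b > 0" using quotient_of_denom_pos[OF ab] .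
  have q: "q = of_int a / of_int b" using quotient_of_div[OF ab] .
  define r where "r = ((a < 0, bits (nat \<bar>a\<bar>)), bits (nat b))"
  have "enc_rat q = encode r"
    by (simp add: enc_rat_def ab r_def enc_int_def encode_bits encode_bool_def)
  moreover have "rval r = of_rat q"
    using b by (auto simp: rval_def r_def bval_bits q of_rat_divide)
  moreover have "q < 0 \<longleftrightarrow> a < 0" using b by (simp add: q divide_less_0_iff)
  ultimately show ?thesis using b by (intro exI[of _ r]) (simp add: r_def bval_bits)
qed

lemma enc_real_code:
  assumes "x \<in> \<rat>"
  obtains r where "enc_real x = encode r" "rval r = x" "0 < bval (snd r)" "fst (fst r) \<longleftrightarrow> x < 0"
proof -
  obtain q where q: "x = of_rat q" using assms by (rule Rats_cases)
  then have "(THE q. of_rat q = x) = q" by (intro the_equality) simp_all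
  then have "enc_real x = enc_rat q" by (simp add: enc_real_def)
  with enc_rat_code[of q] q that show thesis by auto
qed

definition rat_above :: "nat \<Rightarrow> ratcode \<Rightarrow> bool" where
  "rat_above k r \<longleftrightarrow> \<not> fst (fst r) \<and> bless (bmult k (snd r)) (snd (fst r))"

definition rat_below :: "nat \<Rightarrow> ratcode \<Rightarrow> bool" where
  "rat_below k r \<longleftrightarrow> fst (fst r) \<or> bless (snd (fst r)) (bmult k (snd r))"

lemma rat_above:
  assumes "0 < bval (snd r)" and "fst (fst r) \<longleftrightarrow> rval r < 0"
  shows "rat_above k r \<longleftrightarrow> real k < rval r"
proof (cases "fst (fst r)")
  case True
  then show ?thesis using assms by (simp add: rat_above_def)
next
  case False
  then have "real k < rval r \<longleftrightarrow> real k * real (bval (snd r)) < real (bval (snd (fst r)))"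
    using assms(1) pos_less_divide_eq[of "real (bval (snd r))" "real k" "real (bval (snd (fst r)))"]
    by (simp only: rval_def of_nat_0_less_iff if_False mult_1)
  then have "real k < rval r \<longleftrightarrow> k * bval (snd r) < bval (snd (fst r))"
    by (simp only: of_nat_mult[symmetric] of_nat_less_iff)
  then show ?thesis using False by (simp only: rat_above_def bless bval_bmult simp_thms)
qed

lemma rat_below:
  assumes "0 < bval (snd r)" and "fst (fst r) \<longleftrightarrow> rval r < 0"
  shows "rat_below k r \<longleftrightarrow> rval r < real k"
proof (cases "fst (fst r)")
  case True
  then have "rval r < 0" using assms by simp
  then have "rval r < real k" by (rule order_less_le_trans) simp
  then show ?thesis using True by (simp add: rat_below_def)
next
  case False
  then have "rval r < real k \<longleftrightarrow> real (bval (snd (fst r))) < real k * real (bval (snd r))"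
    using assms(1) pos_divide_less_eq[of "real (bval (snd r))" "real (bval (snd (fst r)))" "real k"]
    by (simp only: rval_def of_nat_0_less_iff if_False mult_1)
  then have "rval r < real k \<longleftrightarrow> bval (snd (fst r)) < k * bval (snd r)"
    by (simp only: of_nat_mult[symmetric] of_nat_less_iff)
  then show ?thesis using False by (simp only: rat_below_def bless bval_bmult simp_thms)
qed

lemma ptime_rat_above [ptime_intros]: "ptime f \<Longrightarrow> ptime g \<Longrightarrow> ptime (\<lambda>a. rat_above (f a) (g a))"
  unfolding rat_above_def by (intro ptime_intros)

lemma ptime_rat_below [ptime_intros]: "ptime f \<Longrightarrow> ptime g \<Longrightarrow> ptime (\<lambda>a. rat_below (f a) (g a))"
  unfolding rat_below_def by (intro ptime_intros)

section \<open>Distances\<close>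

type_synonym edgecode = "bool list \<times> bool list"

definition touches :: "bool list list \<Rightarrow> edgecode \<Rightarrow> bool" where
  "touches R e \<longleftrightarrow> fst e \<in> set R \<or> snd e \<in> set R"

text \<open>One layer of breadth-first search: all edges are tested against the old
  \<open>R\<close>. Duplicates are kept, as a round adds at most \<open>2 * esize es\<close>
  whatever \<open>R\<close> is, and this is the kind of bound that \<open>ptime_fold\<close> asks
  for.\<close>

definition expand :: "edgecode list \<Rightarrow> bool list list \<Rightarrow> bool list list" where
  "expand es R = R @ concat (map (\<lambda>e. if touches R e then [fst e, snd e] else []) es)"

definition reach :: "edgecode list \<Rightarrow> bool list \<Rightarrow> nat \<Rightarrow> bool list list" where
  "reach es c k = fold (\<lambda>_. expand es) (replicate k ()) [c]"

text \<open>The distance of \<open>c\<close> and \<open>e\<close>, capped at \<open>K\<close>: \<open>reach es c k\<close> lists the vertices at distance at most \<open>k\<close>.\<close>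

definition dist_upto :: "nat \<Rightarrow> edgecode list \<Rightarrow> bool list \<Rightarrow> edgecode \<Rightarrow> nat" where
  "dist_upto K es c e = length (filter (\<lambda>k. \<not> touches (reach es c k) e) [0..<K])"

lemma ptime_touches [ptime_intros]: "ptime f \<Longrightarrow> ptime g \<Longrightarrow> ptime (\<lambda>a. touches (f a) (g a))"
proof -
  assume "ptime f" "ptime g"
  moreover have "ptime (\<lambda>t :: bool list list \<times> edgecode.
      (\<exists>x\<in>set (fst t). x = fst (snd t)) \<or> (\<exists>x\<in>set (fst t). x = snd (snd t)))"
    by (intro ptime_intros)
  moreover have "(\<exists>x\<in>set R. x = fst e) \<or> (\<exists>x\<in>set R. x = snd e) \<longleftrightarrow> touches R e" for R e
    by (auto simp: touches_def)
  ultimately show ?thesis using ptime_comp[OF ptime_Pair[of f g]] by fastforce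
qed

lemma esize_expand: "esize (expand es R) \<le> esize R + 2 * esize es"
proof -
  have "esize (concat (map (\<lambda>e. if touches R e then [fst e, snd e] else []) es)) \<le> 2 * esize es"
  proof (induction es)
    case (Cons e es)
    then show ?case by (cases e) auto
  qed simp
  then show ?thesis by (simp add: expand_def)
qed

lemma ptime_reach [ptime_intros]:
  assumes "ptime f" "ptime g" "ptime h" shows "ptime (\<lambda>a. reach (f a) (g a) (h a))"
  unfolding reach_def
proof (rule ptime_fold[where h = "\<lambda>t. 2 * esize (f (fst t))"])
  show "ptime (\<lambda>t. expand (f (fst t)) (snd (snd t)))"
    unfolding expand_def by (intro ptime_intros ptime_comp[OF _ assms(1)])
  show "psize (\<lambda>t. 2 * esize (f (fst t)))"
    by (intro psize_intros psize_ptime ptime_comp[OF _ assms(1)] ptime_intros)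
qed (intro ptime_intros assms | simp add: esize_expand)+

lemma ptime_dist_upto [ptime_intros]:
  assumes "ptime k" "ptime f" "ptime g" "ptime h"
  shows "ptime (\<lambda>a. dist_upto (k a) (f a) (g a) (h a))"
  unfolding dist_upto_def
  by (intro ptime_intros ptime_comp[OF _ assms(2)] ptime_comp[OF _ assms(3)] ptime_comp[OF _ assms(4)] assms(1))

section \<open>Breadth-first search computes the distances\<close>

locale unit_graph =
  fixes G :: inst and vs :: "nat list" and es :: "(nat \<times> nat) list"
  assumes lists: "lists_graph vs es G"
    and edges_in: "\<And>e. e \<in> edges G \<Longrightarrow> e \<subseteq> verts G"
    and card_edge: "\<And>e. e \<in> edges G \<Longrightarrow> card e = 2"
    and weight: "\<And>e. e \<in> edges G \<Longrightarrow> weight G e = 1"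
begin

abbreviation ecode :: "nat \<times> nat \<Rightarrow> edgecode" where
  "ecode \<equiv> map_prod bits bits"

text \<open>The ball of radius \<open>k\<close> around \<open>c\<close>: a walk with
  \<open>k\<close> edges lists \<open>Suc k\<close> vertices.\<close>

definition near :: "nat \<Rightarrow> nat \<Rightarrow> nat set" where
  "near c k = {v. \<exists>p\<in>walks G c v. length p \<le> Suc k}"

lemma edges_eq: "edges G = edge_of ` set es"
  using lists by (auto simp: lists_graph_def)

lemma walks_snoc:
  assumes "p \<noteq> []"
  shows "p @ [v] \<in> walks G c v \<longleftrightarrow> p \<in> walks G c (last p) \<and> {last p, v} \<in> edges G"
proof -
  obtain n where n: "length p = Suc n" using assms by (cases p) auto
  define Q where "Q k \<longleftrightarrow> {(p @ [v]) ! k, (p @ [v]) ! Suc k} \<in> edges G" for k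
  have "Q n \<longleftrightarrow> {last p, v} \<in> edges G"
    using n assms by (simp add: Q_def nth_append last_conv_nth)
  moreover have "Q k \<longleftrightarrow> {p ! k, p ! Suc k} \<in> edges G" if "k < n" for k
    using that n by (simp add: Q_def nth_append)
  ultimately have "(\<forall>k < Suc n. Q k) \<longleftrightarrow> (\<forall>k < n. {p ! k, p ! Suc k} \<in> edges G) \<and> {last p, v} \<in> edges G"
    unfolding All_less_Suc by blast
  then show ?thesis using assms n by (simp add: walks_def Q_def)
qed

lemma near_0: "near c 0 = {c}"
proof
  show "near c 0 \<subseteq> {c}"
  proof
    fix v assume "v \<in> near c 0"
    then obtain p where p: "p \<in> walks G c v" "length p \<le> 1" by (auto simp: near_def)
    then show "v \<in> {c}" by (cases p) (auto simp: walks_def)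
  qed
  have "[c] \<in> walks G c c" by (simp add: walks_def)
  then show "{c} \<subseteq> near c 0" by (force simp: near_def)
qed

lemma near_Suc: "near c (Suc k) = near c k \<union> \<Union> {e \<in> edges G. e \<inter> near c k \<noteq> {}}"
proof
  show "near c (Suc k) \<subseteq> near c k \<union> \<Union> {e \<in> edges G. e \<inter> near c k \<noteq> {}}"
  proof
    fix v assume "v \<in> near c (Suc k)"
    then obtain p where p: "p \<in> walks G c v" "length p \<le> Suc (Suc k)" by (auto simp: near_def)
    show "v \<in> near c k \<union> \<Union> {e \<in> edges G. e \<inter> near c k \<noteq> {}}"
    proof (cases "length p \<le> Suc k")
      case True
      with p show ?thesis by (auto simp: near_def)
    next
      case False
      then obtain q u where q: "p = q @ [u]" by (cases p rule: rev_cases) auto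
      then have "q \<noteq> []" "u = v" using False p by (auto simp: walks_def)
      with p q walks_snoc[of q v c] have "q \<in> walks G c (last q)" "{last q, v} \<in> edges G" by auto
      moreover have "last q \<in> near c k" using calculation p q by (auto simp: near_def)
      ultimately show ?thesis by blast
    qed
  qed
  show "near c k \<union> \<Union> {e \<in> edges G. e \<inter> near c k \<noteq> {}} \<subseteq> near c (Suc k)"
  proof -
    have "near c k \<subseteq> near c (Suc k)" by (force simp: near_def)
    moreover have "v \<in> near c (Suc k)" if "e \<in> edges G" "u \<in> e" "u \<in> near c k" "v \<in> e" for e u v
    proof (cases "u = v")
      case True
      then show ?thesis using that calculation by blast
    next
      case False
      have "e = {u, v}" using card_edge[OF that(1)] that False by (auto simp: card_2_iff)
      moreover obtain p where p: "p \<in> walks G c u" "length p \<le> Suc k" using \<open>u \<in> near c k\<close> unfolding near_def by blast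
      moreover have "p \<noteq> []" "last p = u" using p by (auto simp: walks_def)
      ultimately have "p @ [v] \<in> walks G c v" using walks_snoc[of p v c] that by simp
      then show ?thesis using p unfolding near_def by (intro CollectI bexI[of _ "p @ [v]"]) auto
    qed
    ultimately show ?thesis by blast
  qed
qed

lemma set_reach: "set (reach (map ecode es) (bits c) k) = bits ` near c k"
proof (induction k)
  case 0
  show ?case by (simp add: reach_def near_0)
next
  case (Suc k)
  let ?R = "reach (map ecode es) (bits c) k"
  have touch: "touches ?R (ecode a) \<longleftrightarrow> edge_of a \<inter> near c k \<noteq> {}" for a
    by (auto simp: touches_def Suc edge_of_def inj_image_mem_iff[OF inj_bits])
  have "reach (map ecode es) (bits c) (Suc k) = expand (map ecode es) ?R"
    unfolding reach_def by (simp only: replicate_Suc replicate_append_same[symmetric] fold_append) simp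
  then have "set (reach (map ecode es) (bits c) (Suc k)) =
      set ?R \<union> \<Union> ((\<lambda>a. if touches ?R (ecode a) then bits ` edge_of a else {}) ` set es)"
    by (auto simp: expand_def edge_of_def split: if_splits)
  also have "\<dots> = bits ` near c (Suc k)"
    unfolding near_Suc edges_eq image_Un Suc touch by (auto split: if_splits)
  finally show ?case .
qed

lemma touches_reach: "touches (reach (map ecode es) (bits c) k) (ecode a) \<longleftrightarrow> edge_of a \<inter> near c k \<noteq> {}"
  by (auto simp: touches_def set_reach edge_of_def inj_image_mem_iff[OF inj_bits])

lemma near_mono: "k \<le> l \<Longrightarrow> near c k \<subseteq> near c l"
  by (force simp: near_def)

text \<open>By \<open>near_Suc\<close> a ball determines the next one, so growth that pauses once
  has stopped for good.\<close>

lemma near_stable: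
  assumes "near c (Suc k) = near c k" "k \<le> l" shows "near c l = near c k"
  using assms(2) by (induction l rule: dec_induct) (use assms(1) in \<open>simp_all add: near_Suc\<close>)

lemma near_verts: "c \<in> verts G \<Longrightarrow> near c k \<subseteq> verts G"
  by (induction k) (use edges_in in \<open>auto simp: near_0 near_Suc\<close>)

text \<open>Up to the first hit the balls grow strictly, since otherwise \<open>near_stable\<close>
  would rule out any later hit; and they consist of vertices. So \<open>length vs\<close> rounds
  suffice, and no hit within them means infinite distance.\<close>

lemma least_near:
  assumes c: "c \<in> verts G" and e: "e \<inter> near c k \<noteq> {}"
  shows "(LEAST k. e \<inter> near c k \<noteq> {}) < length vs"
proof -
  define l where "l = (LEAST k. e \<inter> near c k \<noteq> {})"
  have l: "e \<inter> near c l \<noteq> {}" unfolding l_def by (rule LeastI[of "\<lambda>k. e \<inter> near c k \<noteq> {}", OF e])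
  have before: "e \<inter> near c j = {}" if "j < l" for j
    using that not_less_Least unfolding l_def by blast
  have V: "finite (verts G)" "card (verts G) = length vs"
    using lists unfolding lists_graph_def by (metis List.finite_set, metis distinct_card)
  have "Suc j \<le> card (near c j)" if "j \<le> l" for j
    using that
  proof (induction j)
    case 0
    show ?case by (simp add: near_0)
  next
    case (Suc j)
    have "near c (Suc j) \<noteq> near c j"
      using near_stable[of c j l] before[of j] l Suc.prems by auto
    then have "near c j \<subset> near c (Suc j)" using near_mono[of j "Suc j" c] by auto
    then have "card (near c j) < card (near c (Suc j))"
      using near_verts[OF c] V by (meson finite_subset psubset_card_mono)
    with Suc show ?case by simp
  qed
  from this[of l] have "Suc l \<le> card (near c l)" by simp
  also have "\<dots> \<le> length vs" using near_verts[OF c] V by (metis card_mono)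
  finally show ?thesis by (simp add: l_def)
qed

lemma walk_length: "p \<in> walks G c v \<Longrightarrow> walk_length G p = real (length p - 1)"
  by (simp add: walk_length_def walks_def weight)

text \<open>With unit weights the length of a walk is its number of edges. The radii without contact
  to the edge are those below the first hit, so counting them yields the distance.\<close>

lemma Min_distance:
  assumes c: "c \<in> verts G" and a: "a \<in> set es"
  shows "Min (distance G c ` edge_of a) =
    (let d = dist_upto (length vs) (map ecode es) (bits c) (ecode a)
     in if d < length vs then ereal (real d) else \<infinity>)"
proof -
  let ?e = "edge_of a"
  define hit where "hit k \<longleftrightarrow> ?e \<inter> near c k \<noteq> {}" for k
  have mono: "hit k \<Longrightarrow> k \<le> l \<Longrightarrow> hit l" for k l
    unfolding hit_def using near_mono[of k l c] by blast
  have dist: "dist_upto (length vs) (map ecode es) (bits c) (ecode a) = card {k. k < length vs \<and> \<not> hit k}"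
    unfolding dist_upto_def touches_reach hit_def[symmetric]
    by (subst distinct_card[symmetric]) (auto intro: arg_cong[of _ _ card])
  have inf: "Min (distance G c ` ?e) = (INF v\<in>?e. distance G c v)"
    by (intro Min_Inf) (auto simp: edge_of_def)
  show ?thesis
  proof (cases "\<exists>k. hit k")
    case False
    then have "walks G c v = {}" if "v \<in> ?e" for v
      using that by (auto simp: hit_def near_def) (metis (mono_tags, lifting) disjoint_iff le_SucI le_refl mem_Collect_eq)
    then have "distance G c v = \<infinity>" if "v \<in> ?e" for v
      using that by (simp add: distance_def top_ereal_def)
    then have "Min (distance G c ` ?e) = \<infinity>"
      unfolding inf by (auto simp: edge_of_def)
    moreover have "{k. k < length vs \<and> \<not> hit k} = {..<length vs}" using False by auto
    ultimately show ?thesis by (simp add: dist)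
  next
    case True
    define l where "l = (LEAST k. hit k)"
    have l: "hit l" unfolding l_def using True by (rule LeastI_ex)
    have before: "\<not> hit j" if "j < l" for j
      using that not_less_Least unfolding l_def by blast
    have l_less: "l < length vs"
      using least_near[OF c, of ?e l] l unfolding l_def hit_def by simp
    have "{k. k < length vs \<and> \<not> hit k} = {..<l}"
      using l_less before mono[OF l] by (auto simp: not_less) (meson not_less)
    then have d: "dist_upto (length vs) (map ecode es) (bits c) (ecode a) = l" by (simp add: dist)
    have "(INF v\<in>?e. distance G c v) = ereal (real l)"
    proof (rule antisym)
      obtain v p where v: "v \<in> ?e" "p \<in> walks G c v" "length p \<le> Suc l"
        using l by (auto simp: hit_def near_def)
      have "(INF v\<in>?e. distance G c v) \<le> distance G c v" using v by (intro INF_lower)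
      also have "\<dots> \<le> ereal (walk_length G p)" unfolding distance_def using v by (intro INF_lower)
      also have "\<dots> \<le> ereal (real l)" using v walk_length by auto
      finally show "(INF v\<in>?e. distance G c v) \<le> ereal (real l)" .
    next
      show "ereal (real l) \<le> (INF v\<in>?e. distance G c v)"
        unfolding distance_def
      proof (intro INF_greatest)
        fix v p assume v: "v \<in> ?e" "p \<in> walks G c v"
        then have "p \<noteq> []" by (auto simp: walks_def)
        then have "hit (length p - 1)" using v by (auto simp: hit_def near_def)
        then have "l \<le> length p - 1" using before by (meson not_less)
        then show "ereal (real l) \<le> ereal (walk_length G p)" using walk_length[OF v(2)] by simp
      qed
    qed
    with inf d l_less show ?thesis by simp
  qed
qed

end

section \<open>Districts as sets of slots\<close>

text \<open>District \<open>d\<close> is split into the slots \<open>(d, 0), (d, 1), \<dots>\<close>, each of which takes one edge. The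
  mandatory slots have to be filled, and the absent ones must not be used.\<close>

lemma fill_slots:
  fixes g :: "nat \<Rightarrow> nat"
  assumes g: "\<And>i. i < m \<Longrightarrow> g i < p"
  obtains t where "inj_on t {..<m}" "\<And>i. i < m \<Longrightarrow> fst (t i) = g i"
    "t ` {..<m} = (SIGMA d:{..<p}. {..<card {i. i < m \<and> g i = d}})"
proof
  define n where "n d = card {i. i < m \<and> g i = d}" for d
  \<comment> \<open>Each edge takes the slot numbered by the earlier edges of its district, so the
    slots in use form an initial segment. Counting turns the inclusion shown below into an
    equality.\<close>
  define t where "t i = (g i, card {j. j < i \<and> g j = g i})" for i
  show inj: "inj_on t {..<m}"
  proof (rule linorder_inj_onI')
    fix i j assume ij: "i \<in> {..<m}" "j \<in> {..<m}" "i < j"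
    show "t i \<noteq> t j"
    proof
      assume eq: "t i = t j"
      then have "{k. k < i \<and> g k = g i} \<subset> {k. k < j \<and> g k = g j}"
        using ij by (auto simp: t_def)
      then have "card {k. k < i \<and> g k = g i} < card {k. k < j \<and> g k = g j}"
        by (intro psubset_card_mono) auto
      with eq show False by (simp add: t_def)
    qed
  qed
  have sub: "t ` {..<m} \<subseteq> (SIGMA d:{..<p}. {..<n d})"
  proof
    fix y assume "y \<in> t ` {..<m}"
    then obtain i where i: "i < m" "y = t i" by auto
    then have "{j. j < i \<and> g j = g i} \<subset> {j. j < m \<and> g j = g i}" by auto
    then have "card {j. j < i \<and> g j = g i} < n (g i)"
      unfolding n_def by (intro psubset_card_mono) auto
    then show "y \<in> (SIGMA d:{..<p}. {..<n d})" using i g by (auto simp: t_def)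
  qed
  have "(\<Sum>d<p. n d) = m"
  proof -
    have "(\<Sum>d<p. sum (\<lambda>_. 1) {i \<in> {..<m}. g i = d}) = sum (\<lambda>_. 1::nat) {..<m}"
      using g by (intro sum.group) auto
    then show ?thesis by (simp add: n_def)
  qed
  then have "card (SIGMA d:{..<p}. {..<n d}) = card (t ` {..<m})"
    using inj by (simp add: card_image)
  then show "t ` {..<m} = (SIGMA d:{..<p}. {..<card {i. i < m \<and> g i = d}})"
    using sub unfolding n_def by (intro card_subset_eq) auto
qed (simp add: g)

text \<open>The number of edges is fixed, so charging for the other slots rewards filling the
  mandatory ones. Both charges are independent because a slot may be mandatory and absent at once,
  for instance \<open>k = 1\<close> when both bounds are 1.5.\<close>

definition slot_penalty :: "(nat \<Rightarrow> bool) \<Rightarrow> (nat \<Rightarrow> bool) \<Rightarrow> nat \<Rightarrow> nat" where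
  "slot_penalty mand absent k = (if mand k then 0 else 1) + (if absent k then 1 else 0)"

text \<open>A feasible allocation can fill all mandatory slots and avoid the absent ones; this minimizes the
  total penalty. As \<open>F\<close> outweighs all other costs, so does an optimal assignment.\<close>

lemma optimal_slots:
  fixes c :: "nat \<Rightarrow> nat \<Rightarrow> nat"
  assumes inj: "inj_on s {..<m}" and ran: "s ` {..<m} \<subseteq> {..<p} \<times> {..<m}"
    and opt: "\<And>t. inj_on t {..<m} \<Longrightarrow> t ` {..<m} \<subseteq> {..<p} \<times> {..<m} \<Longrightarrow>
        (\<Sum>i<m. c i (fst (s i)) + F * slot_penalty mand absent (snd (s i))) \<le>
        (\<Sum>i<m. c i (fst (t i)) + F * slot_penalty mand absent (snd (t i)))"
    and c: "\<And>i d. i < m \<Longrightarrow> d < p \<Longrightarrow> c i d \<le> B" and F: "m * B < F"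
    and g: "\<And>i. i < m \<Longrightarrow> g i < p"
    and mand: "\<And>d k. d < p \<Longrightarrow> k < m \<Longrightarrow> mand k \<Longrightarrow> k < card {i. i < m \<and> g i = d}"
    and absent: "\<And>d k. d < p \<Longrightarrow> k < card {i. i < m \<and> g i = d} \<Longrightarrow> \<not> absent k"
  shows "\<And>d k. d < p \<Longrightarrow> k < m \<Longrightarrow> mand k \<Longrightarrow> (d, k) \<in> s ` {..<m}"
    and "\<And>i. i < m \<Longrightarrow> \<not> absent (snd (s i))"
    and "(\<Sum>i<m. c i (fst (s i))) \<le> (\<Sum>i<m. c i (g i))"
proof -
  obtain t where t: "inj_on t {..<m}" "\<And>i. i < m \<Longrightarrow> fst (t i) = g i"
    "t ` {..<m} = (SIGMA d:{..<p}. {..<card {i. i < m \<and> g i = d}})"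
    using fill_slots[of m g p] g by blast
  have le_m: "card {i. i < m \<and> g i = d} \<le> m" for d
    using card_mono[of "{..<m}" "{i. i < m \<and> g i = d}"] by auto
  have t_ran: "t ` {..<m} \<subseteq> {..<p} \<times> {..<m}"
    unfolding t(3) using le_m by (auto intro: less_le_trans)
  define Mand where "Mand = {q \<in> {..<p} \<times> {..<m}. mand (snd q)}"
  define used where "used r = {i \<in> {..<m}. mand (snd (r i))}" for r :: "nat \<Rightarrow> nat \<times> nat"
  define bad where "bad r = {i \<in> {..<m}. absent (snd (r i))}" for r :: "nat \<Rightarrow> nat \<times> nat"
  define pen where "pen r = (\<Sum>i<m. slot_penalty mand absent (snd (r i)))" for r :: "nat \<Rightarrow> nat \<times> nat"
  have fin: "finite Mand" "finite (used r)" "finite (bad r)" for r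
    by (auto simp: Mand_def used_def bad_def)
  \<comment> \<open>The penalty is the number of edges outside mandatory slots plus the number of
    edges in absent slots.\<close>
  have pen: "pen r + card (used r) = m + card (bad r)" for r
  proof -
    have "pen r + card (used r) = (\<Sum>i<m. slot_penalty mand absent (snd (r i)) + of_bool (mand (snd (r i))))"
      by (simp add: pen_def used_def sum.distrib Int_def)
    also have "\<dots> = (\<Sum>i<m. 1 + of_bool (absent (snd (r i))))"
      by (intro sum.cong) (auto simp: slot_penalty_def)
    also have "\<dots> = m + card (bad r)"
      unfolding sum.distrib by (simp add: bad_def Int_def)
    finally show ?thesis .
  qed
  have card_used: "card (used r) = card (r ` used r)" if "inj_on r {..<m}" for r
    using that by (intro card_image[symmetric]) (auto simp: used_def inj_on_def)
  have s_used: "s ` used s \<subseteq> Mand" using ran by (auto simp: used_def Mand_def)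
  have "Mand \<subseteq> t ` {..<m}"
    unfolding t(3) using mand by (auto simp: Mand_def)
  then have "t ` used t = Mand" using t_ran by (auto simp: used_def Mand_def)
  then have t_used: "card (used t) = card Mand" using card_used t by simp
  have "snd (t i) < card {j. j < m \<and> g j = fst (t i)} \<and> fst (t i) < p" if "i < m" for i
  proof -
    from that have "t i \<in> t ` {..<m}" by simp
    then show ?thesis unfolding t(3) by auto
  qed
  then have t_bad: "bad t = {}" using absent by (auto simp: bad_def)
  have T: "(\<Sum>i<m. c i (fst (r i)) + F * slot_penalty mand absent (snd (r i))) =
      (\<Sum>i<m. c i (fst (r i))) + F * pen r" for r
    by (simp add: pen_def sum.distrib sum_distrib_left)
  have le: "(\<Sum>i<m. c i (fst (s i))) + F * pen s \<le> (\<Sum>i<m. c i (g i)) + F * pen t"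
    using opt[OF t(1) t_ran] t(2) unfolding T by simp
  have "(\<Sum>i<m. c i (g i)) \<le> (\<Sum>i<m. B)" using c g by (intro sum_mono) auto
  then have "(\<Sum>i<m. c i (g i)) < F" using F by simp
  \<comment> \<open>The other costs of \<open>t\<close> stay below \<open>F\<close>, so they cannot
    make up for even one unit of penalty.\<close>
  then have "F * pen s < F * Suc (pen t)" using le by simp
  then have pen_le: "pen s \<le> pen t" by (simp only: mult_less_cancel1) simp
  \<comment> \<open>\<open>t\<close> fills all mandatory slots and avoids all absent ones, which is
    the best possible in both respects. So a penalty no larger than that of \<open>t\<close> forces
    \<open>s\<close> to attain both extremes.\<close>
  have "card (s ` used s) \<le> card Mand" using s_used fin by (intro card_mono)
  then have "card (s ` used s) = card Mand" "card (bad s) = 0" and pen_eq: "pen s = pen t"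
    using pen[of s] pen[of t] pen_le t_used t_bad card_used[OF inj] by simp_all
  then have eq: "card (s ` used s) = card Mand" "bad s = {}" using fin by simp_all
  have "s ` used s = Mand" using s_used fin eq by (intro card_subset_eq) auto
  then show "\<And>d k. d < p \<Longrightarrow> k < m \<Longrightarrow> mand k \<Longrightarrow> (d, k) \<in> s ` {..<m}"
    by (auto simp: Mand_def used_def)
  show "\<And>i. i < m \<Longrightarrow> \<not> absent (snd (s i))"
    using eq by (auto simp: bad_def)
  show "(\<Sum>i<m. c i (fst (s i))) \<le> (\<Sum>i<m. c i (g i))"
    using le pen_eq by simp
qed

text \<open>Slots of a district may be filled with gaps, so its load is not read off directly. A
  load below \<open>lower\<close> would make the slots from 0 up to the load mandatory, hence
  filled, which is one too many. The largest slot in use bounds the load from above.\<close>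

lemma balanced_slots:
  fixes lower upper :: real
  assumes inj: "inj_on s {..<m}" and ran: "s ` {..<m} \<subseteq> {..<p} \<times> {..<m}"
    and lower: "lower \<le> real m" and upper: "0 \<le> upper"
    and mand: "\<And>d k. d < p \<Longrightarrow> k < m \<Longrightarrow> real k < lower \<Longrightarrow> (d, k) \<in> s ` {..<m}"
    and absent: "\<And>i. i < m \<Longrightarrow> \<not> upper < real (Suc (snd (s i)))"
    and d: "d < p"
  shows "lower \<le> real (card {i. i < m \<and> fst (s i) = d})"
    and "real (card {i. i < m \<and> fst (s i) = d}) \<le> upper"
proof -
  define I where "I = {i. i < m \<and> fst (s i) = d}"
  define K where "K = (\<lambda>i. snd (s i)) ` I"
  have "inj_on (\<lambda>i. snd (s i)) I"
    using inj by (auto simp: I_def inj_on_def prod_eq_iff)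
  then have card: "card I = card K" by (simp add: K_def card_image)
  have fin: "finite K" by (simp add: K_def I_def)
  show "lower \<le> real (card {i. i < m \<and> fst (s i) = d})"
  proof (rule ccontr)
    assume "\<not> ?thesis"
    then have less: "real (card K) < lower" by (simp add: I_def[symmetric] card)
    have "k \<in> K" if k: "k \<le> card K" for k
    proof -
      have "real k < lower" using k less by linarith
      then have "(d, k) \<in> s ` {..<m}" using mand[OF d, of k] lower by linarith
      then obtain i where "i < m" "s i = (d, k)" by auto
      then show ?thesis unfolding K_def I_def by (intro image_eqI[of _ _ i]) simp_all
    qed
    then have "{..card K} \<subseteq> K" by auto
    then have "card {..card K} \<le> card K" using fin by (intro card_mono)
    then show False by simp
  qed
  show "real (card {i. i < m \<and> fst (s i) = d}) \<le> upper"
  proof (cases "K = {}")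
    case True
    then show ?thesis using upper by (simp add: I_def[symmetric] card)
  next
    case False
    define k where "k = Max K"
    have "K \<subseteq> {..k}" using fin by (auto simp: k_def)
    then have "card K \<le> Suc k" using card_mono[of "{..k}" K] by simp
    moreover have "k \<in> K" using fin False by (simp add: k_def)
    then have "real (Suc k) \<le> upper" using absent by (auto simp: K_def I_def not_less)
    ultimately show ?thesis by (simp add: I_def[symmetric] card)
  qed
qed

section \<open>The algorithm\<close>

text \<open>The seven-element list built by \<open>enc_input\<close>, read as nested pairs. The
  first \<open>unit\<close> is the \<open>Leaf\<close> in place of the weights, the last one the end
  of the list.\<close>

type_synonym input = "bool list list \<times> edgecode list \<times> bool list \<times> unit \<times> ratcode \<times> ratcode \<times>
  bool list list \<times> unit"

definition in_verts :: "input \<Rightarrow> bool list list" where "in_verts x = fst x"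
definition in_edges :: "input \<Rightarrow> edgecode list" where "in_edges x = fst (snd x)"
definition in_lower :: "input \<Rightarrow> ratcode" where "in_lower x = fst (snd (snd (snd (snd x))))"
definition in_upper :: "input \<Rightarrow> ratcode" where "in_upper x = fst (snd (snd (snd (snd (snd x)))))"
definition in_centers :: "input \<Rightarrow> bool list list" where
  "in_centers x = fst (snd (snd (snd (snd (snd (snd x))))))"

definition infinite_cost :: "input \<Rightarrow> nat" where
  "infinite_cost x = Suc (length (in_edges x) * length (in_verts x))"

definition edge_cost :: "input \<Rightarrow> nat \<Rightarrow> edgecode \<Rightarrow> nat" where
  "edge_cost x d e =
     (let r = dist_upto (length (in_verts x)) (in_edges x) (nth_default [] (in_centers x) d) e
      in if r < length (in_verts x) then r else infinite_cost x)"

definition penalty_factor :: "input \<Rightarrow> nat" where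
  "penalty_factor x = Suc (length (in_edges x) * infinite_cost x)"

text \<open>Filled from the bottom, a district uses slot \<open>k\<close> iff it has at least
  \<open>k + 1\<close> edges. Every admissible size is that large if \<open>k < lower\<close>, and
  none is if \<open>k + 1 > upper\<close>.\<close>

definition penalty :: "input \<Rightarrow> nat \<Rightarrow> nat" where
  "penalty x k = slot_penalty (\<lambda>k. rat_above k (in_lower x)) (\<lambda>k. rat_below (Suc k) (in_upper x)) k"

definition slots :: "input \<Rightarrow> (nat \<times> nat) list" where
  "slots x = List.product [0..<length (in_centers x)] [0..<length (in_edges x)]"

text \<open>The factor \<open>m + 1\<close> makes the auction, which is optimal up to \<open>m\<close>, exact.\<close>

definition cost_matrix :: "input \<Rightarrow> nat list list" where
  "cost_matrix x = map (\<lambda>e. map (\<lambda>q. Suc (length (in_edges x)) *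
     (edge_cost x (fst q) e + penalty_factor x * penalty x (snd q))) (slots x)) (in_edges x)"

definition placement :: "input \<Rightarrow> (nat \<times> nat \<times> nat) list" where
  "placement x = map (\<lambda>a. (fst a, nth_default (0, 0) (slots x) (snd a)))
     (auction (length (slots x)) (cost_matrix x))"

definition out_matrix :: "input \<Rightarrow> tree list list" where
  "out_matrix x = map (\<lambda>d. map (\<lambda>i.
      if \<exists>a\<in>set (placement x). fst a = i \<and> fst (snd a) = d then enc_real 1 else enc_real 0)
      [0..<length (in_edges x)]) [0..<length (in_centers x)]"

text \<open>The test checks the hypotheses of \<open>balanced_slots\<close>; by
  \<open>optimal_slots\<close> it can only fail if no allocation is feasible.\<close>

definition solve :: "input \<Rightarrow> tree" where
  "solve x =
     (if (\<forall>q\<in>set (slots x). rat_above (snd q) (in_lower x) \<longrightarrow>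
            (\<exists>a\<in>set (placement x). fst (snd a) = fst q \<and> snd (snd a) = snd q)) \<and>
         (\<forall>a\<in>set (placement x). \<not> rat_below (Suc (snd (snd a))) (in_upper x))
      then encode (out_matrix x, ()) else Leaf)"

section \<open>Polynomial time of the algorithm\<close>

lemma ptime_comp3:
  assumes "ptime (\<lambda>t. F (fst t) (fst (snd t)) (snd (snd t)))" "ptime f" "ptime g" "ptime h"
  shows "ptime (\<lambda>a. F (f a) (g a) (h a))"
  using ptime_comp[OF ptime_Pair[OF assms(2) ptime_Pair[OF assms(3,4)]] assms(1)] by simp

lemma ptime_imp [ptime_intros]: "ptime f \<Longrightarrow> ptime g \<Longrightarrow> ptime (\<lambda>a. f a \<longrightarrow> g a)"
  using ptime_disj[OF ptime_not[of f], of g] by (simp only: imp_conv_disj)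

lemma ptime_product [ptime_intros]:
  assumes "ptime f" "ptime g" shows "ptime (\<lambda>a. List.product (f a) (g a))"
  unfolding product_concat_map
  by (intro ptime_intros assms ptime_comp[OF _ assms(2)])

lemma ptime_input [ptime_intros]:
  assumes "ptime f"
  shows "ptime (\<lambda>a. in_verts (f a))" "ptime (\<lambda>a. in_edges (f a))" "ptime (\<lambda>a. in_lower (f a))"
    "ptime (\<lambda>a. in_upper (f a))" "ptime (\<lambda>a. in_centers (f a))"
  unfolding in_verts_def in_edges_def in_lower_def in_upper_def in_centers_def
  by (intro ptime_intros assms)+

lemma ptime_infinite_cost [ptime_intros]: "ptime f \<Longrightarrow> ptime (\<lambda>a. infinite_cost (f a))"
  unfolding infinite_cost_def by (intro ptime_intros)

lemma ptime_penalty_factor [ptime_intros]: "ptime f \<Longrightarrow> ptime (\<lambda>a. penalty_factor (f a))"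
  unfolding penalty_factor_def by (intro ptime_intros)

lemma ptime_slots [ptime_intros]: "ptime f \<Longrightarrow> ptime (\<lambda>a. slots (f a))"
  unfolding slots_def by (intro ptime_intros)

lemma ptime_edge_cost [ptime_intros]:
  "ptime f \<Longrightarrow> ptime g \<Longrightarrow> ptime h \<Longrightarrow> ptime (\<lambda>a. edge_cost (f a) (g a) (h a))"
  by (rule ptime_comp3[of edge_cost]) (unfold edge_cost_def, intro ptime_intros)

lemma ptime_penalty [ptime_intros]:
  "ptime f \<Longrightarrow> ptime g \<Longrightarrow> ptime (\<lambda>a. penalty (f a) (g a))"
  unfolding penalty_def slot_penalty_def by (intro ptime_intros)

lemma ptime_cost_matrix [ptime_intros]: "ptime f \<Longrightarrow> ptime (\<lambda>a. cost_matrix (f a))"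
  by (erule ptime_comp) (unfold cost_matrix_def, intro ptime_intros)

lemma ptime_placement [ptime_intros]: "ptime f \<Longrightarrow> ptime (\<lambda>a. placement (f a))"
  by (erule ptime_comp) (unfold placement_def, intro ptime_intros)

lemma ptime_out_matrix [ptime_intros]: "ptime f \<Longrightarrow> ptime (\<lambda>a. out_matrix (f a))"
  by (erule ptime_comp) (unfold out_matrix_def, intro ptime_intros)

lemma ptime_solve: "ptime solve"
  unfolding solve_def[abs_def] by (intro ptime_intros)

section \<open>Correctness\<close>

lemma enc_list_map: "enc_list (\<lambda>a. encode (f a)) xs = encode (map f xs)"
  by (induction xs) (simp_all add: enc_list_def)

abbreviation variant :: "group set" where
  "variant \<equiv> {Balance, Integrality, Compactness}"

locale districting = unit_graph +
  fixes \<alpha> :: real and lo up :: ratcode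
  assumes \<alpha>: "0 \<le> \<alpha>"
    and ndist: "1 \<le> ndist G" "ndist G \<le> card (edges G)"
    and centers: "\<And>i. i \<in> {1..ndist G} \<Longrightarrow> center G i \<in> verts G"
    and mean: "lower G \<le> mean_weight G" "mean_weight G \<le> upper G"
    and lo: "rval lo = lower G" "0 < bval (snd lo)" "fst (fst lo) \<longleftrightarrow> lower G < 0"
    and up: "rval up = upper G" "0 < bval (snd up)" "fst (fst up) \<longleftrightarrow> upper G < 0"
    and fin: "finite (verts G)"
begin

definition code :: input where
  "code = (map bits vs, map ecode es, bits (ndist G), (), lo, up,
     map (\<lambda>i. bits (center G i)) [1..<Suc (ndist G)], ())"

abbreviation m where "m \<equiv> length es"
abbreviation p where "p \<equiv> ndist G"
abbreviation E where "E i \<equiv> edge_of (es ! i)"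

lemma code_simps [simp]:
  "in_verts code = map bits vs" "in_edges code = map ecode es" "in_lower code = lo" "in_upper code = up"
  "in_centers code = map (\<lambda>i. bits (center G i)) [1..<Suc (ndist G)]"
  by (simp_all only: code_def in_verts_def in_edges_def in_lower_def in_upper_def in_centers_def fst_conv snd_conv)

lemma inj_E: "inj_on E {..<m}"
  using lists by (auto simp: lists_graph_def inj_on_def distinct_conv_nth)

lemma edges_E: "edges G = E ` {..<m}"
  unfolding edges_eq by (force simp: in_set_conv_nth)

lemma card_edges: "card (edges G) = m"
  unfolding edges_E by (simp add: card_image[OF inj_E])

lemma m_pos: "1 \<le> m" "p \<le> m" using ndist card_edges by auto

lemma mean_eq: "mean_weight G = real m / real p"
  by (simp add: mean_weight_def weight card_edges)

text \<open>Side conditions of \<open>balanced_slots\<close>, obtained from the mean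
  \<open>m / p\<close> lying between the bounds.\<close>

lemma bounds: "lower G \<le> real m" "0 \<le> upper G"
proof -
  have "real m / real p \<le> real m / 1" using ndist by (intro divide_left_mono) auto
  then show "lower G \<le> real m" using mean by (simp add: mean_eq)
  have "0 \<le> mean_weight G" by (simp add: mean_eq)
  then show "0 \<le> upper G" using mean(2) by (rule order_trans)
qed

lemma length_vs_le: "length vs \<le> m * length vs"
  using mult_le_mono1[OF m_pos(1), of "length vs"] by (simp only: mult_1)

lemma infinite_cost: "infinite_cost code = Suc (m * length vs)"
  by (simp only: infinite_cost_def code_simps length_map)

definition c :: "nat \<Rightarrow> nat \<Rightarrow> nat" where
  "c i d = edge_cost code d (ecode (es ! i))"

lemma Min_distance_c:
  assumes "i < m" "d < p"
  shows "Min (distance G (center G (Suc d)) ` E i) = (if c i d < length vs then ereal (real (c i d)) else \<infinity>)"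
    and "c i d < length vs \<or> c i d = Suc (m * length vs)"
proof -
  have "center G (Suc d) \<in> verts G" "es ! i \<in> set es" using assms centers by auto
  note * = Min_distance[OF this]
  have center: "nth_default [] (in_centers code) d = bits (center G (Suc d))"
    using assms by (simp add: nth_default_def del: upt_Suc)
  have c: "c i d = (let r = dist_upto (length vs) (map ecode es) (bits (center G (Suc d))) (ecode (es ! i))
      in if r < length vs then r else infinite_cost code)"
    unfolding c_def edge_cost_def center by simp
  have "length vs \<le> infinite_cost code"
    unfolding infinite_cost by (rule le_SucI[OF length_vs_le])
  then show "Min (distance G (center G (Suc d)) ` E i) = (if c i d < length vs then ereal (real (c i d)) else \<infinity>)"
    unfolding * c by (simp add: Let_def)
  show "c i d < length vs \<or> c i d = Suc (m * length vs)"
    unfolding c by (simp add: Let_def infinite_cost)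
qed

lemma c_le: "i < m \<Longrightarrow> d < p \<Longrightarrow> c i d \<le> infinite_cost code"
proof -
  assume "i < m" "d < p"
  then have "c i d < length vs \<or> c i d = Suc (m * length vs)" by (rule Min_distance_c)
  then show ?thesis unfolding infinite_cost using length_vs_le by linarith
qed

text \<open>\<open>good f\<close>: allocating the \<open>i\<close>-th edge to district \<open>f i + 1\<close> is feasible.\<close>

definition good :: "(nat \<Rightarrow> nat) \<Rightarrow> bool" where
  "good f \<longleftrightarrow> (\<forall>i<m. f i < p) \<and>
     (\<forall>d<p. lower G \<le> real (card {i. i < m \<and> f i = d}) \<and> real (card {i. i < m \<and> f i = d}) \<le> upper G)"

definition compactness :: "(nat \<Rightarrow> nat) \<Rightarrow> ereal" where
  "compactness f = (\<Sum>i<m. edge_distance \<alpha> G (center G (Suc (f i))) (E i))"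

definition alloc_of :: "(nat \<Rightarrow> nat) \<Rightarrow> alloc" where
  "alloc_of f d e = (if \<exists>i<m. E i = e \<and> Suc (f i) = d then 1 else 0)"

definition given_centers :: centers where
  "given_centers i v = (if v = center G i then 1 else 0)"

section \<open>Integral solutions as functions from edges to districts\<close>

lemma alloc_of_E: "i < m \<Longrightarrow> alloc_of f d (E i) = (if Suc (f i) = d then 1 else 0)"
  using inj_E unfolding alloc_of_def inj_on_def by auto

lemma sum_edges: "(\<Sum>e\<in>edges G. h e) = (\<Sum>i<m. h (E i))"
  unfolding edges_E by (simp add: sum.reindex[OF inj_E])

lemma weight_E: "i < m \<Longrightarrow> weight G (E i) = 1"
  using weight edges_E by auto

lemma load_eq:
  assumes "\<And>i. i < m \<Longrightarrow> x d (E i) = (if Suc (f i) = d then 1 else 0)" and "d = Suc d'"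
  shows "(\<Sum>e\<in>edges G. weight G e * x d e) = real (card {i. i < m \<and> f i = d'})"
proof -
  have "(\<Sum>e\<in>edges G. weight G e * x d e) = (\<Sum>i<m. if f i = d' then 1 else 0)"
    unfolding sum_edges using assms weight_E by (intro sum.cong) auto
  also have "\<dots> = real (card {i. i < m \<and> f i = d'})"
    by (simp add: sum.If_cases Int_def)
  finally show ?thesis .
qed

text \<open>Fixed centers and 0/1 allocations leave one term per edge. All other terms have a factor
  0, which also kills infinite distances.\<close>

lemma objective_eq:
  assumes f: "\<And>i. i < m \<Longrightarrow> f i < p"
    and x: "\<And>i d. i < m \<Longrightarrow> d \<in> {1..p} \<Longrightarrow> x d (E i) = (if Suc (f i) = d then 1 else 0)"
    and w: "centers_fixed G w"
  shows "objective \<alpha> variant G x w = compactness f"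
proof -
  have "objective \<alpha> variant G x w = (\<Sum>v\<in>verts G. \<Sum>d=1..p. \<Sum>i<m.
      ereal (w d v) * edge_distance \<alpha> G v (E i) * ereal (x d (E i)))"
    by (simp add: objective_def sum_edges)
  also have "\<dots> = (\<Sum>d=1..p. \<Sum>i<m. \<Sum>v\<in>verts G.
      ereal (w d v) * edge_distance \<alpha> G v (E i) * ereal (x d (E i)))"
    by (subst sum.swap) (intro sum.cong refl sum.swap)
  also have "\<dots> = (\<Sum>d=1..p. \<Sum>i<m. edge_distance \<alpha> G (center G d) (E i) * ereal (x d (E i)))"
  proof (intro sum.cong refl)
    fix d i assume d: "d \<in> {1..p}"
    have "(\<Sum>v\<in>verts G. ereal (w d v) * edge_distance \<alpha> G v (E i) * ereal (x d (E i))) =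
        (\<Sum>v\<in>verts G. if v = center G d then edge_distance \<alpha> G v (E i) * ereal (x d (E i)) else 0)"
      using w d by (intro sum.cong) (auto simp: centers_fixed_def one_ereal_def[symmetric] zero_ereal_def[symmetric])
    then show "(\<Sum>v\<in>verts G. ereal (w d v) * edge_distance \<alpha> G v (E i) * ereal (x d (E i))) =
        edge_distance \<alpha> G (center G d) (E i) * ereal (x d (E i))"
      using fin centers[OF d] by simp
  qed
  also have "\<dots> = (\<Sum>i<m. \<Sum>d=1..p. edge_distance \<alpha> G (center G d) (E i) * ereal (x d (E i)))"
    by (rule sum.swap)
  also have "\<dots> = compactness f"
    unfolding compactness_def
  proof (intro sum.cong refl)
    fix i assume "i \<in> {..<m}"
    then have i: "i < m" by simp
    have "(\<Sum>d=1..p. edge_distance \<alpha> G (center G d) (E i) * ereal (x d (E i))) =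
        (\<Sum>d=1..p. if d = Suc (f i) then edge_distance \<alpha> G (center G d) (E i) else 0)"
      using x[OF i] by (intro sum.cong) (auto simp: one_ereal_def[symmetric] zero_ereal_def[symmetric])
    then show "(\<Sum>d=1..p. edge_distance \<alpha> G (center G d) (E i) * ereal (x d (E i))) =
        edge_distance \<alpha> G (center G (Suc (f i))) (E i)"
      using f[OF i] by simp
  qed
  finally show ?thesis .
qed

lemma feasible_alloc_of:
  assumes "good f"
  shows "feasible variant G (alloc_of f) given_centers"
    and "objective \<alpha> variant G (alloc_of f) given_centers = compactness f"
proof -
  have f: "f i < p" if "i < m" for i using assms that by (auto simp: good_def)
  have "structural G (alloc_of f) given_centers"
    unfolding structural_def
  proof (intro conjI ballI)
    fix e assume "e \<in> edges G"
    then obtain i where i: "i < m" "e = E i" using edges_E by auto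
    have "(\<Sum>d=1..p. alloc_of f d e) = (\<Sum>d=1..p. if d = Suc (f i) then 1 else 0)"
      by (intro sum.cong) (auto simp: i alloc_of_E)
    then show "(\<Sum>d=1..p. alloc_of f d e) = 1" using f[OF i(1)] by simp
  next
    fix d assume "d \<in> {1..p}"
    then show "sum (given_centers d) (verts G) = 1"
      using fin centers by (simp add: given_centers_def)
  qed (auto simp: alloc_of_def given_centers_def)
  moreover have "balanced G (alloc_of f)"
    unfolding balanced_def
  proof
    fix d assume "d \<in> {1..p}"
    then obtain d' where d: "d = Suc d'" "d' < p" by (cases d) auto
    show "lower G \<le> (\<Sum>e\<in>edges G. weight G e * alloc_of f d e) \<and>
        (\<Sum>e\<in>edges G. weight G e * alloc_of f d e) \<le> upper G"
      using assms d by (subst (1 2) load_eq[of "alloc_of f" d f d']) (auto simp: alloc_of_E good_def)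
  qed
  moreover have "integral_alloc G (alloc_of f)" by (simp add: integral_alloc_def alloc_of_def)
  moreover have cf: "centers_fixed G given_centers" by (simp add: centers_fixed_def given_centers_def)
  ultimately show "feasible variant G (alloc_of f) given_centers" by (simp add: feasible_def)
  show "objective \<alpha> variant G (alloc_of f) given_centers = compactness f"
    by (rule objective_eq[OF f _ cf]) (simp_all add: alloc_of_E)
qed

text \<open>An edge's entries are 0 or 1 and sum to 1, so exactly one is 1. Together with
  \<open>feasible_alloc_of\<close>, this turns the optimization into one over functions satisfying
  \<open>good\<close>.\<close>

lemma feasible_good:
  assumes "feasible variant G x w"
  obtains f where "good f" "objective \<alpha> variant G x w = compactness f"
proof -
  have st: "structural G x w" and bal: "balanced G x" and int: "integral_alloc G x"
    and cf: "centers_fixed G w"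
    using assms by (auto simp: feasible_def)
  have "\<exists>d<p. \<forall>d'\<in>{1..p}. x d' (E i) = (if Suc d = d' then 1 else 0)" if i: "i < m" for i
  proof -
    have Ei: "E i \<in> edges G" using i edges_E by auto
    have sum: "(\<Sum>d=1..p. x d (E i)) = 1" using st Ei by (simp add: structural_def)
    have 01: "x d (E i) = 0 \<or> x d (E i) = 1" if "d \<in> {1..p}" for d
      using int Ei that by (auto simp: integral_alloc_def)
    obtain d where d: "d \<in> {1..p}" "x d (E i) = 1"
      using sum 01 by (metis (no_types, lifting) sum.neutral zero_neq_one)
    have "(\<Sum>d\<in>{1..p} - {d}. x d (E i)) = 0"
      using sum d by (simp add: sum_diff1)
    moreover have "0 \<le> x d' (E i)" if "d' \<in> {1..p} - {d}" for d' using 01[of d'] that by auto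
    ultimately have "\<forall>d'\<in>{1..p} - {d}. x d' (E i) = 0"
      by (subst (asm) sum_nonneg_eq_0_iff) auto
    with d show ?thesis by (intro exI[of _ "d - 1"]) auto
  qed
  then obtain f where f: "\<And>i. i < m \<Longrightarrow> f i < p"
    "\<And>i d. i < m \<Longrightarrow> d \<in> {1..p} \<Longrightarrow> x d (E i) = (if Suc (f i) = d then 1 else 0)"
    by metis
  have "good f"
    unfolding good_def
  proof (intro conjI allI impI)
    fix d assume d: "d < p"
    have "(\<Sum>e\<in>edges G. weight G e * x (Suc d) e) = real (card {i. i < m \<and> f i = d})"
      using f d by (intro load_eq) auto
    then show "lower G \<le> real (card {i. i < m \<and> f i = d})" "real (card {i. i < m \<and> f i = d}) \<le> upper G"
      using bal d by (auto simp: balanced_def Ball_def elim!: allE[of _ "Suc d"])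
  qed (rule f)
  moreover have "objective \<alpha> variant G x w = compactness f" by (rule objective_eq[of f x w]) (fact f cf)+
  ultimately show thesis by (rule that)
qed

text \<open>If \<open>g\<close> meets an infinite distance, nothing is to be shown. Otherwise its
  integer cost is at most \<open>m * length vs\<close>, below the stand-in for infinity, so
  \<open>f\<close> avoids infinite distances too; then both objectives exceed the integer costs by
  the same \<open>m * \<alpha>\<close>.\<close>

lemma compactness_le:
  assumes f: "\<And>i. i < m \<Longrightarrow> f i < p" and g: "\<And>i. i < m \<Longrightarrow> g i < p"
    and le: "(\<Sum>i<m. c i (f i)) \<le> (\<Sum>i<m. c i (g i))"
  shows "compactness f \<le> compactness g"
proof -
  have dist: "edge_distance \<alpha> G (center G (Suc d)) (E i) =
      (if c i d < length vs then ereal (real (c i d) + \<alpha>) else \<infinity>)" if "i < m" "d < p" for i d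
    using Min_distance_c(1)[OF that] weight_E[OF that(1)] by (simp add: edge_distance_def)
  show ?thesis
  proof (cases "\<forall>i<m. c i (g i) < length vs")
    case False
    then have "compactness g = \<infinity>"
      unfolding compactness_def using dist g by (subst sum_Pinfty) auto
    then show ?thesis by simp
  next
    case True
    have "(\<Sum>i<m. c i (g i)) \<le> (\<Sum>i<m. length vs)"
      using True by (intro sum_mono) (auto intro: less_imp_le)
    then have small: "(\<Sum>i<m. c i (f i)) < Suc (m * length vs)" using le by simp
    have fin: "c i (f i) < length vs" if "i < m" for i
    proof -
      have "c i (f i) \<le> (\<Sum>i<m. c i (f i))" using that by (intro member_le_sum) auto
      with small Min_distance_c(2)[OF that f[OF that]] show ?thesis by auto
    qed
    have "compactness f = (\<Sum>i<m. ereal (real (c i (f i)) + \<alpha>))"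
      unfolding compactness_def using dist f fin by (intro sum.cong) auto
    also have "\<dots> = ereal (real (\<Sum>i<m. c i (f i)) + real m * \<alpha>)"
      by (simp add: sum_ereal sum.distrib)
    also have "\<dots> \<le> ereal (real (\<Sum>i<m. c i (g i)) + real m * \<alpha>)"
      using le by (simp only: ereal_less_eq add_le_cancel_right of_nat_le_iff)
    also have "\<dots> = (\<Sum>i<m. ereal (real (c i (g i)) + \<alpha>))"
      by (simp add: sum_ereal sum.distrib)
    also have "\<dots> = compactness g"
      unfolding compactness_def using dist g True by (intro sum.cong) auto
    finally show ?thesis .
  qed
qed

section \<open>The assignment found by the auction\<close>

lemma set_slots: "set (slots code) = {..<p} \<times> {..<m}"
  by (auto simp: slots_def simp del: upt_Suc)

lemma length_slots: "length (slots code) = p * m"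
  by (simp add: slots_def del: upt_Suc)

lemma distinct_slots: "distinct (slots code)"
  by (simp add: slots_def distinct_product del: upt_Suc)

lemma placement:
  obtains s where "set (placement code) = (\<lambda>i. (i, s i)) ` {..<m}"
    and "inj_on s {..<m}" and "s ` {..<m} \<subseteq> {..<p} \<times> {..<m}"
    and "\<And>t. inj_on t {..<m} \<Longrightarrow> t ` {..<m} \<subseteq> {..<p} \<times> {..<m} \<Longrightarrow>
        (\<Sum>i<m. c i (fst (s i)) + penalty_factor code * penalty code (snd (s i))) \<le>
        (\<Sum>i<m. c i (fst (t i)) + penalty_factor code * penalty code (snd (t i)))"
proof -
  let ?N = "length (slots code)" and ?M = "cost_matrix code" and ?S = "slots code"
  define u where "u i q = c i (fst q) + penalty_factor code * penalty code (snd q)" for i q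
  have len: "length ?M = m" by (simp add: cost_matrix_def)
  have entry: "?M ! i ! j = Suc m * u i (?S ! j)" if "i < m" "j < ?N" for i j
    using that by (simp add: cost_matrix_def u_def c_def)
  interpret assignment_problem ?N ?M
  proof
    show "length r = ?N" if "r \<in> set ?M" for r using that by (auto simp: cost_matrix_def)
    show "length ?M \<le> ?N" using ndist(1) by (simp add: len length_slots)
  qed
  obtain \<sigma> where \<sigma>: "set (auction ?N ?M) = (\<lambda>i. (i, \<sigma> i)) ` {..<m}" "inj_on \<sigma> {..<m}" "\<sigma> ` {..<m} \<subseteq> {..<?N}"
    "\<And>\<tau>. inj_on \<tau> {..<m} \<Longrightarrow> \<tau> ` {..<m} \<subseteq> {..<?N} \<Longrightarrow>
      (\<Sum>i<m. ?M ! i ! \<sigma> i) \<le> (\<Sum>i<m. ?M ! i ! \<tau> i) + m"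
    by (rule auction_optimal[unfolded len]) blast
  have bij: "bij_betw ((!) ?S) {..<?N} ({..<p} \<times> {..<m})"
    using bij_betw_nth[OF distinct_slots refl] by (simp add: set_slots)
  define s where "s i = ?S ! \<sigma> i" for i
  show thesis
  proof (rule that[of s])
    have "\<sigma> i < ?N" if "i < m" for i using \<sigma>(3) that by auto
    then show "set (placement code) = (\<lambda>i. (i, s i)) ` {..<m}"
      unfolding placement_def set_map \<sigma>(1) image_image s_def
      by (intro image_cong refl) (simp add: nth_default_def)
    show "inj_on s {..<m}"
      unfolding s_def using comp_inj_on[OF \<sigma>(2)] inj_on_subset[OF bij_betw_imp_inj_on[OF bij] \<sigma>(3)]
      by (simp add: comp_def)
    show "s ` {..<m} \<subseteq> {..<p} \<times> {..<m}"
      unfolding s_def using \<sigma>(3) bij_betw_imp_surj_on[OF bij] by (auto simp: image_subset_iff)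
  next
    fix t assume t: "inj_on t {..<m}" "t ` {..<m} \<subseteq> {..<p} \<times> {..<m}"
    \<comment> \<open>The auction knows slots by their positions, so the competitor \<open>t\<close>
      is carried back along the enumeration of the slots.\<close>
    define \<tau> where "\<tau> i = inv_into {..<?N} ((!) ?S) (t i)" for i
    have \<tau>: "\<tau> i < ?N" "?S ! \<tau> i = t i" if "i < m" for i
    proof -
      have "t i \<in> (!) ?S ` {..<?N}" using t(2) that bij_betw_imp_surj_on[OF bij] by blast
      then show "\<tau> i < ?N" "?S ! \<tau> i = t i"
        unfolding \<tau>_def using inv_into_into[of "t i" "(!) ?S" "{..<?N}"] f_inv_into_f[of "t i" "(!) ?S" "{..<?N}"]
        by auto
    qed
    have "inj_on \<tau> {..<m}"
      using t(1) \<tau>(2) by (metis (no_types, lifting) inj_on_def lessThan_iff)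
    moreover have "\<tau> ` {..<m} \<subseteq> {..<?N}" using \<tau>(1) by auto
    ultimately have "(\<Sum>i<m. ?M ! i ! \<sigma> i) \<le> (\<Sum>i<m. ?M ! i ! \<tau> i) + m" by (rule \<sigma>(4))
    moreover have "(\<Sum>i<m. ?M ! i ! \<sigma> i) = Suc m * (\<Sum>i<m. u i (s i))"
      unfolding sum_distrib_left using \<sigma>(3) by (intro sum.cong) (auto simp: entry s_def image_subset_iff)
    moreover have "(\<Sum>i<m. ?M ! i ! \<tau> i) = Suc m * (\<Sum>i<m. u i (t i))"
      unfolding sum_distrib_left using \<tau> by (intro sum.cong) (auto simp: entry)
    \<comment> \<open>The error \<open>m\<close> is smaller than the common factor
      \<open>Suc m\<close>; stated as a strict inequality, this survives cancelling the
      factor.\<close>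
    ultimately have "Suc m * (\<Sum>i<m. u i (s i)) < Suc m * Suc (\<Sum>i<m. u i (t i))" by simp
    then have "(\<Sum>i<m. u i (s i)) < Suc (\<Sum>i<m. u i (t i))" by (simp only: mult_less_cancel1)
    then show "(\<Sum>i<m. c i (fst (s i)) + penalty_factor code * penalty code (snd (s i))) \<le>
        (\<Sum>i<m. c i (fst (t i)) + penalty_factor code * penalty code (snd (t i)))"
      unfolding u_def by simp
  qed
qed

lemma out_matrix:
  assumes "set (placement code) = (\<lambda>i. (i, s i)) ` {..<m}"
  shows "encode (out_matrix code, ()) = enc_solution variant vs es G (alloc_of (\<lambda>i. fst (s i))) given_centers"
proof -
  define f where "f i = fst (s i)" for i
  have "out_matrix code = map (\<lambda>d. map (\<lambda>i. enc_real (alloc_of f (Suc d) (E i))) [0..<m]) [0..<p]"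
    unfolding out_matrix_def assms
    by (auto simp: alloc_of_E f_def simp del: upt_Suc)
  also have "\<dots> = map (\<lambda>d. map (\<lambda>a. enc_real (alloc_of f d (edge_of a))) es) (map Suc [0..<p])"
  proof -
    have "map (\<lambda>i. h (es ! i)) [0..<m] = map h es" for h :: "nat \<times> nat \<Rightarrow> tree"
      using map_nth[of es] by (metis (no_types, lifting) map_map comp_def map_eq_conv)
    from this[of "\<lambda>a. enc_real (alloc_of f _ (edge_of a))"] show ?thesis by simp
  qed
  finally have "out_matrix code = map (\<lambda>d. map (\<lambda>a. enc_real (alloc_of f d (edge_of a))) es) [1..<Suc p]"
    by (simp only: map_Suc_upt One_nat_def)
  moreover have "enc_list h es = encode (map h es)" for h :: "nat \<times> nat \<Rightarrow> tree"
    using enc_list_map[of h es] by simp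
  ultimately show ?thesis
    unfolding enc_solution_def f_def[symmetric] by (simp only: enc_list_map encode_Pair) simp
qed

text \<open>The test \<open>ok\<close> of the program is equivalent to feasibility:
  \<open>good_f\<close> gives one direction, and \<open>best\<close> the other one along with
  optimality.\<close>

lemma solve_correct: "solve code \<in> correct_outputs \<alpha> variant vs es G"
proof -
  obtain s where s: "set (placement code) = (\<lambda>i. (i, s i)) ` {..<m}"
    "inj_on s {..<m}" "s ` {..<m} \<subseteq> {..<p} \<times> {..<m}"
    and opt: "\<And>t. inj_on t {..<m} \<Longrightarrow> t ` {..<m} \<subseteq> {..<p} \<times> {..<m} \<Longrightarrow>
        (\<Sum>i<m. c i (fst (s i)) + penalty_factor code * penalty code (snd (s i))) \<le>
        (\<Sum>i<m. c i (fst (t i)) + penalty_factor code * penalty code (snd (t i)))"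
    using placement by blast
  have above: "rat_above k lo \<longleftrightarrow> real k < lower G" and below: "rat_below k up \<longleftrightarrow> upper G < real k" for k
    using rat_above[of lo k] rat_below[of up k] lo up by simp_all
  define f where "f i = fst (s i)" for i
  have f: "f i < p" if "i < m" for i using s(3) that by (auto simp: f_def)
  define ok where "ok \<longleftrightarrow> (\<forall>d<p. \<forall>k<m. real k < lower G \<longrightarrow> (d, k) \<in> s ` {..<m}) \<and>
     (\<forall>i<m. \<not> upper G < real (Suc (snd (s i))))"
  have slots_ok: "(\<forall>q\<in>set (slots code). rat_above (snd q) (in_lower code) \<longrightarrow>
            (\<exists>a\<in>set (placement code). fst (snd a) = fst q \<and> snd (snd a) = snd q)) \<and>
         (\<forall>a\<in>set (placement code). \<not> rat_below (Suc (snd (snd a))) (in_upper code)) \<longleftrightarrow> ok"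
  proof -
    have "(\<exists>a\<in>(\<lambda>i. (i, s i)) ` {..<m}. fst (snd a) = fst q \<and> snd (snd a) = snd q) \<longleftrightarrow> q \<in> s ` {..<m}" for q
      by (cases q) (force simp: prod_eq_iff image_iff)
    then show ?thesis
      unfolding set_slots s(1) code_simps above below ok_def by auto
  qed
  have solve: "solve code = (if ok then enc_solution variant vs es G (alloc_of f) given_centers else Leaf)"
    unfolding solve_def slots_ok out_matrix[OF s(1)] f_def by (rule refl)
  have good_f: "good f" if ok
    using that f balanced_slots[OF s(2,3) bounds] by (auto simp: good_def ok_def f_def)
  have best: "ok \<and> (\<Sum>i<m. c i (f i)) \<le> (\<Sum>i<m. c i (g i))" if g: "good g" for g
  proof -
    have gp: "g i < p" if "i < m" for i using g that by (auto simp: good_def)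
    have n_m: "card {i. i < m \<and> g i = d} \<le> m" for d
      using card_mono[of "{..<m}" "{i. i < m \<and> g i = d}"] by auto
    have F: "m * infinite_cost code < penalty_factor code" by (simp add: penalty_factor_def)
    have 1: "k < card {i. i < m \<and> g i = d}" if "d < p" "k < m" "rat_above k lo" for d k
    proof -
      have "lower G \<le> real (card {i. i < m \<and> g i = d})" using g that by (simp add: good_def)
      then show ?thesis using that(3) unfolding above by linarith
    qed
    have 2: "\<not> rat_below (Suc k) up" if "d < p" "k < card {i. i < m \<and> g i = d}" for d k
    proof -
      have "real (card {i. i < m \<and> g i = d}) \<le> upper G" using g that by (simp add: good_def)
      moreover have "real (Suc k) \<le> real (card {i. i < m \<and> g i = d})" using that by simp
      ultimately show ?thesis unfolding below by linarith
    qed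
    have pen: "penalty code k = slot_penalty (\<lambda>k. rat_above k lo) (\<lambda>k. rat_below (Suc k) up) k" for k
      by (simp add: penalty_def)
    note opt' = opt[unfolded pen]
    note opt_slots = optimal_slots[where s = s and m = m and p = p and c = c and g = g and
        F = "penalty_factor code" and B = "infinite_cost code" and
        mand = "\<lambda>k. rat_above k lo" and absent = "\<lambda>k. rat_below (Suc k) up"]
    have "(d, k) \<in> s ` {..<m}" if "d < p" "k < m" "rat_above k lo" for d k
      by (rule opt_slots(1)) (fact s(2) s(3) opt' c_le F gp 1 2 that)+
    moreover have "\<not> rat_below (Suc (snd (s i))) up" if "i < m" for i
      by (rule opt_slots(2)) (fact s(2) s(3) opt' c_le F gp 1 2 that)+
    moreover have "(\<Sum>i<m. c i (fst (s i))) \<le> (\<Sum>i<m. c i (g i))"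
      by (rule opt_slots(3)) (fact s(2) s(3) opt' c_le F gp 1 2)+
    ultimately show ?thesis unfolding ok_def f_def above below by blast
  qed
  show ?thesis
  proof (cases "\<exists>x w. feasible variant G x w")
    case True
    then obtain g where "good g" using feasible_good by metis
    then have ok using best by blast
    then have good: "good f" by (rule good_f)
    have "optimal \<alpha> variant G (alloc_of f) given_centers"
      unfolding optimal_def
    proof (intro conjI allI impI)
      show "feasible variant G (alloc_of f) given_centers" by (rule feasible_alloc_of[OF good])
      fix x w assume "feasible variant G x w"
      then obtain g where g: "good g" "objective \<alpha> variant G x w = compactness g" by (rule feasible_good)
      have "compactness f \<le> compactness g"
        using best[OF g(1)] f g(1) by (intro compactness_le) (auto simp: good_def)
      then show "objective \<alpha> variant G (alloc_of f) given_centers \<le> objective \<alpha> variant G x w"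
        by (simp add: feasible_alloc_of[OF good] g)
    qed
    moreover have "rational_solution G (alloc_of f)"
      by (simp add: rational_solution_def alloc_of_def)
    ultimately show ?thesis using True \<open>ok\<close> unfolding correct_outputs_def solve by auto
  next
    case False
    then have "\<not> ok" using good_f feasible_alloc_of by blast
    then show ?thesis using False unfolding correct_outputs_def solve by auto
  qed
qed

lemma encode_code:
  assumes "enc_real (lower G) = encode lo" "enc_real (upper G) = encode up"
  shows "enc_input variant vs es G = encode code"
proof -
  have "enc_list enc_nat vs = encode (map bits vs)"
    using enc_list_map[of bits vs] by (simp add: encode_bits)
  moreover have "enc_list (\<lambda>(u, v). Node (enc_nat u) (enc_nat v)) es = encode (map ecode es)"
    using enc_list_map[of ecode es] by (simp add: encode_bits case_prod_unfold encode_prod_def)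
  moreover have "enc_list (\<lambda>i. enc_nat (center G i)) [1..<Suc p] =
      encode (map (\<lambda>i. bits (center G i)) [1..<Suc p])"
    using enc_list_map[of "\<lambda>i. bits (center G i)" "[1..<Suc p]"] by (simp only: encode_bits)
  ultimately show ?thesis
    using assms by (simp add: enc_input_def code_def enc_list_def encode_bits del: upt_Suc)
qed

end

theorem theorem3:
  fixes \<alpha> :: real
  assumes "0 \<le> \<alpha>" and "\<alpha> \<le> 1"
  shows "solvable_in_polynomial_time (theta \<alpha> {Balance, Integrality, Compactness})"
proof (rule solvable_in_polynomial_timeI[OF ptime_solve])
  fix t R assume "(t, R) \<in> theta \<alpha> variant"
  then obtain vs es G where t: "t = enc_input variant vs es G" "R = correct_outputs \<alpha> variant vs es G"
    and inst: "is_instance variant G" and rat: "rational_data G" and lists: "lists_graph vs es G"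
    by (auto simp: theta_def)
  obtain lo where lo_code: "enc_real (lower G) = encode lo" "rval lo = lower G" "0 < bval (snd lo)"
    "fst (fst lo) \<longleftrightarrow> lower G < 0"
    using rat enc_real_code[of "lower G"] by (auto simp: rational_data_def)
  obtain up where up_code: "enc_real (upper G) = encode up" "rval up = upper G" "0 < bval (snd up)"
    "fst (fst up) \<longleftrightarrow> upper G < 0"
    using rat enc_real_code[of "upper G"] by (auto simp: rational_data_def)
  interpret districting G vs es \<alpha> lo up
    using inst lists assms lo_code up_code by unfold_locales (auto simp: is_instance_def)
  have "encode (solve code) \<in> R" using solve_correct by (simp add: t)
  moreover have "t = encode code" using encode_code[OF lo_code(1) up_code(1)] by (simp only: t)
  ultimately show "\<exists>a. t = encode a \<and> encode (solve a) \<in> R" by blast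
qed

end
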